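(* Let $\mathcal{H}$ be a Hilbert space and let $F:\mathcal{B}(\mathbb{R})\to\mathcal{L}_s^+(\mathcal{H})$ be a normalized POVM which is absolutely continuous with respect to a finite measure $\nu$ on $\mathcal{B}(\mathbb{R})$. Then $F$ is commutative if and only if there exist a self-adjoint operator $A$ on $\mathcal{H}$ and a strong Feller Markov kernel $\mu:\mathbb{R}\times\mathcal{B}(\mathbb{R})\to[0,1]$ such that $F(\Delta)=\mu_\Delta(A)$ for every $\Delta\in\mathcal{B}(\mathbb{R})$.
   Context: $\mathcal{B}(\mathbb{R})$ is the Borel $\sigma$-algebra of $\mathbb{R}$; $\mathcal{L}_s^+(\mathcal{H})$ is the set of positive bounded self-adjoint operators on $\mathcal{H}$. A POVM (semispectral measure) is a map $F:\mathcal{B}(\mathbb{R})\to\mathcal{L}_s^+(\mathcal{H})$ with $F(\bigcup_n\Delta_n)=\sum_nF(\Delta_n)$ for every countable family of pairwise disjoint Borel sets, the series converging in the weak operator topology. It is normalized if $F(\mathbb{R})=\mathbf{1}$ (the identity), and commutative if all the operators $F(\Delta)$ commute with each other. $F$ is absolutely continuous with respect to a measure $\nu$ on $\mathcal{B}(\mathbb{R})$ if there is a positive number $c$ such that $\|F(\Delta)\|\le c\,\nu(\Delta)$ for each $\Delta\in\mathcal{B}(\mathbb{R})$. A Markov kernel is a map $\mu:\mathbb{R}\times\mathcal{B}(\mathbb{R})\to[0,1]$, $(\lambda,\Delta)\mapsto\mu_\Delta(\lambda)$, such that $\mu_\Delta(\cdot)$ is Borel measurable for each $\Delta\in\mathcal{B}(\mathbb{R})$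 and $\mu_{(\cdot)}(\lambda)$ is a probability measure for each $\lambda\in\mathbb{R}$. It is strong Feller if $\mu_\Delta(\cdot)$ is continuous for each $\Delta\in\mathcal{B}(\mathbb{R})$. $\mu_\Delta(A)=\int\mu_\Delta(\lambda)\,dE^A_\lambda$ is defined by the Borel functional calculus, $E^A$ being the spectral measure of $A$. *)

theory Defs
  imports "HOL-Probability.Probability"
begin

text \<open>Complex Hilbert spaces. The inner product is linear in its second argument. Completeness
  comes from \<^class>\<open>banach\<close>, and positive definiteness of the inner product from the norm
  axioms together with \<open>cinner_self\<close>.\<close>

class chilbert_space = banach +
  fixes scaleC :: "complex \<Rightarrow> 'a \<Rightarrow> 'a" (infixr "*\<^sub>C" 75)
    and cinner :: "'a \<Rightarrow> 'a \<Rightarrow> complex"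
  assumes scaleC_add_right: "a *\<^sub>C (x + y) = a *\<^sub>C x + a *\<^sub>C y"
    and scaleC_add_left: "(a + b) *\<^sub>C x = a *\<^sub>C x + b *\<^sub>C x"
    and scaleC_scaleC: "a *\<^sub>C (b *\<^sub>C x) = (a * b) *\<^sub>C x"
    and scaleC_of_real: "complex_of_real r *\<^sub>C x = r *\<^sub>R x"
    and cinner_commute: "cinner x y = cnj (cinner y x)"
    and cinner_add_right: "cinner x (y + z) = cinner x y + cinner x z"
    and cinner_scaleC_right: "cinner x (a *\<^sub>C y) = a * cinner x y"
    and cinner_self: "cinner x x = complex_of_real ((norm x)\<^sup>2)"

instantiation complex :: chilbert_space
begin

definition scaleC_complex :: "complex \<Rightarrow> complex \<Rightarrow> complex"
  where "scaleC_complex a x = a * x"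

definition cinner_complex :: "complex \<Rightarrow> complex \<Rightarrow> complex"
  where "cinner_complex x y = cnj x * y"

instance
proof
  fix x :: complex
  show "cinner x x = complex_of_real ((norm x)\<^sup>2)"
    unfolding cinner_complex_def by (simp only: complex_norm_square mult.commute)
qed (simp_all add: scaleC_complex_def cinner_complex_def algebra_simps scaleR_conv_of_real)

end

text \<open>A possibly unbounded operator is given by its domain \<open>D\<close> and a function \<open>T\<close>, whose values
  outside \<open>D\<close> are irrelevant. A bounded operator is a \<open>blinfun\<close>, which is only real-linear;
  complex linearity is the extra condition \<open>clinear_on UNIV\<close>.\<close>

definition clinear_on :: "'a::chilbert_space set \<Rightarrow> ('a \<Rightarrow> 'a) \<Rightarrow> bool" where
  "clinear_on D T \<longleftrightarrow>
     0 \<in> D \<and> (\<forall>x\<in>D. \<forall>y\<in>D. x + y \<in> D \<and> T (x + y) = T x + T y) \<and>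
     (\<forall>a. \<forall>x\<in>D. a *\<^sub>C x \<in> D \<and> T (a *\<^sub>C x) = a *\<^sub>C T x)"

text \<open>\<open>y\<close> belongs to the domain of the adjoint of \<open>(D, T)\<close>, and the adjoint maps \<open>y\<close> to \<open>z\<close>.\<close>

definition adjoint_maps :: "'a::chilbert_space set \<Rightarrow> ('a \<Rightarrow> 'a) \<Rightarrow> 'a \<Rightarrow> 'a \<Rightarrow> bool" where
  "adjoint_maps D T y z \<longleftrightarrow> (\<forall>x\<in>D. cinner y (T x) = cinner z x)"

definition self_adjoint :: "'a::chilbert_space set \<Rightarrow> ('a \<Rightarrow> 'a) \<Rightarrow> bool" where
  "self_adjoint D T \<longleftrightarrow> clinear_on D T \<and> closure D = UNIV \<and>
     (\<forall>y z. adjoint_maps D T y z \<longleftrightarrow> y \<in> D \<and> T y = z)"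

definition positive_operators :: "('a::chilbert_space \<Rightarrow>\<^sub>L 'a) set" where
  "positive_operators = {T. self_adjoint UNIV (blinfun_apply T) \<and> 
                            (\<forall>x. 0 \<le> Re (cinner x (blinfun_apply T x)))}"

definition povm :: "(real set \<Rightarrow> ('a::chilbert_space \<Rightarrow>\<^sub>L 'a)) \<Rightarrow> bool" where
  "povm F \<longleftrightarrow> (\<forall>\<Delta>\<in>sets borel. F \<Delta> \<in> positive_operators) \<and>
     (\<forall>\<Delta>. range \<Delta> \<subseteq> sets borel \<and> disjoint_family \<Delta> \<longrightarrow>
        (\<forall>x y. (\<lambda>n::nat. cinner x (blinfun_apply (F (\<Delta> n)) y)) sums
                 cinner x (blinfun_apply (F (\<Union>n. \<Delta> n)) y)))"

definition normalized_povm :: "(real set \<Rightarrow> ('a::chilbert_space \<Rightarrow>\<^sub>L 'a)) \<Rightarrow> bool" where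
  "normalized_povm F \<longleftrightarrow> povm F \<and> F UNIV = id_blinfun"

definition commutative_povm :: "(real set \<Rightarrow> ('a::chilbert_space \<Rightarrow>\<^sub>L 'a)) \<Rightarrow> bool" where
  "commutative_povm F \<longleftrightarrow>
     (\<forall>\<Delta>\<in>sets borel. \<forall>\<Delta>'\<in>sets borel. F \<Delta> o\<^sub>L F \<Delta>' = F \<Delta>' o\<^sub>L F \<Delta>)"

definition absolutely_continuous_povm ::
    "real measure \<Rightarrow> (real set \<Rightarrow> ('a::chilbert_space \<Rightarrow>\<^sub>L 'a)) \<Rightarrow> bool" where
  "absolutely_continuous_povm \<nu> F \<longleftrightarrow>
     (\<exists>c::real. c > 0 \<and> (\<forall>\<Delta>\<in>sets borel. ennreal (norm (F \<Delta>)) \<le> ennreal c * emeasure \<nu> \<Delta>))"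

definition pvm :: "(real set \<Rightarrow> ('a::chilbert_space \<Rightarrow>\<^sub>L 'a)) \<Rightarrow> bool" where
  "pvm E \<longleftrightarrow> normalized_povm E \<and> (\<forall>\<Delta>\<in>sets borel. E \<Delta> o\<^sub>L E \<Delta> = E \<Delta>)"

text \<open>The finite positive measure sending \<open>\<Delta>\<close> to \<open>\<langle>x, E(\<Delta>) x\<rangle>\<close>.\<close>

definition scalar_measure ::
    "(real set \<Rightarrow> ('a::chilbert_space \<Rightarrow>\<^sub>L 'a)) \<Rightarrow> 'a \<Rightarrow> real measure" where
  "scalar_measure E x =
     measure_of UNIV (sets borel) (\<lambda>\<Delta>. ennreal (Re (cinner x (blinfun_apply (E \<Delta>) x))))"

text \<open>\<open>(D, T)\<close> is the operator \<open>\<integral> f dE\<close>. Its domain consists of the \<open>x\<close> with \<open>f\<close>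
  square-integrable with respect to \<open>\<langle>x, E(\<cdot>) x\<rangle>\<close>. Since \<open>T\<close> is linear on the complex subspace
  \<open>D\<close>, its values on \<open>D\<close> are determined, by polarization, by \<open>\<langle>x, T x\<rangle> = \<integral> f d\<langle>x, E(\<cdot>) x\<rangle>\<close>
  (when \<open>D\<close> is dense).\<close>

definition has_spectral_integral ::
    "(real set \<Rightarrow> ('a::chilbert_space \<Rightarrow>\<^sub>L 'a)) \<Rightarrow> (real \<Rightarrow> real) \<Rightarrow> 'a set \<Rightarrow> ('a \<Rightarrow> 'a) \<Rightarrow> bool"
  where
  "has_spectral_integral E f D T \<longleftrightarrow>
     f \<in> borel_measurable borel \<and> clinear_on D T \<and>
     D = {x. integrable (scalar_measure E x) (\<lambda>t. (f t)\<^sup>2)} \<and>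
     (\<forall>x\<in>D. cinner x (T x) = complex_of_real (\<integral>t. f t \<partial>scalar_measure E x))"

text \<open>\<open>E\<close> is the spectral measure of \<open>(D, A)\<close>: the projection-valued measure with \<open>A = \<integral> t dE(t)\<close>.
  Its values are determined on Borel sets only, whence a relation rather than a function.\<close>

definition is_spectral_measure ::
    "(real set \<Rightarrow> ('a::chilbert_space \<Rightarrow>\<^sub>L 'a)) \<Rightarrow> 'a set \<Rightarrow> ('a \<Rightarrow> 'a) \<Rightarrow> bool" where
  "is_spectral_measure E D A \<longleftrightarrow> pvm E \<and> has_spectral_integral E (\<lambda>t. t) D A"

text \<open>A Markov kernel assigns to each \<open>l\<close> the probability measure \<open>\<mu> l\<close>, so that
  \<open>measure (\<mu> l) \<Delta>\<close> is \<open>\<mu>\<^sub>\<Delta>(l)\<close>. Measurability into \<^const>\<open>prob_algebra\<close> amounts to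
  measurability of \<open>\<mu>\<^sub>\<Delta>\<close> for every Borel set \<open>\<Delta>\<close>.\<close>

definition markov_kernel :: "(real \<Rightarrow> real measure) \<Rightarrow> bool" where
  "markov_kernel \<mu> \<longleftrightarrow> \<mu> \<in> measurable borel (prob_algebra borel)"

definition strong_feller :: "(real \<Rightarrow> real measure) \<Rightarrow> bool" where
  "strong_feller \<mu> \<longleftrightarrow> (\<forall>\<Delta>\<in>sets borel. continuous_on UNIV (\<lambda>l. measure (\<mu> l) \<Delta>))"

end

theory Submission
  imports Defs "HOL-Computational_Algebra.Polynomial"
begin

text \<open>Absolute continuity makes \<open>\<Delta> \<mapsto> F \<Delta>\<close> continuous from \<open>\<nu>\<close> to the operator norm, so the \<open>F \<Delta>\<close> lie in
  the norm-closed algebra generated by the countably many commuting operators \<open>F {..q}\<close>, \<open>q\<close>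
  rational. Each of these is a norm-convergent binary expansion in commuting projections (its binary
  digits), and if \<open>P\<^sub>0, P\<^sub>1, \<dots>\<close> enumerates all these projections, then every \<open>P\<^sub>n\<close> is a norm limit of
  polynomials in the single operator \<open>A = \<Sum>\<^sub>n 63 \<cdot> 64\<^sup>-\<^sup>n\<^sup>-\<^sup>1 P\<^sub>n\<close>. Hence \<open>F \<Delta> = f\<^sub>\<Delta>(A)\<close> with \<open>f\<^sub>\<Delta>\<close>
  continuous on the support \<open>K\<close> of the spectral measure of \<open>A\<close>. On \<open>K\<close> continuous functions are
  determined by their spectral integrals, also as regards order; so \<open>f\<^sub>\<Delta>\<close> is additive in \<open>\<Delta>\<close> and
  \<open>0 \<le> f\<^sub>\<Delta> \<le> c \<nu>(\<Delta>)\<close> pointwise, and a linear monotone extension from \<open>K\<close> to the line gives the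
  kernel. The spectral theorem for \<open>0 \<le> A \<le> 1\<close> is obtained from Bernstein polynomials: they
  turn \<open>A\<close> into discrete measures whose moments converge to \<open>\<langle>x, A\<^sup>j x\<rangle>\<close>, and Helly's theorem yields
  the measure \<open>\<langle>x, E(\<cdot>) x\<rangle>\<close>. Conversely, a spectral integral is a norm limit of linear combinations
  of the commuting projections \<open>E(B)\<close>.\<close>

text \<open>The strong Feller property is the obstacle. The classical construction of one generator
  for commuting operators uses strong limits and presents them as Borel functions of it. Here
  continuous functions are wanted, so whatever expresses \<open>F \<Delta>\<close> through
  \<open>A\<close> has to converge in the operator norm. This is why binary digits enter, although a
  digit is a discontinuous function of its operator: a projection has its spectrum in {0, 1}, and
  this gap allows a weighted sum of projections to be decoded by polynomials in norm, whereas a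
  weighted sum of operators with connected spectra may lose information for good. Nothing requires
  \<open>A\<close> to be a continuous function of the operators \<open>F \<Delta>\<close>;
  continuity is wanted in the other direction only. Throughout, a hermitian operator T on a complex
  space is determined by the numbers <x, T x>, so identities between operators are mostly checked on
  these quadratic forms, which in turn are integrals against scalar measures.\<close>

lemma cinner_add_left: "cinner (x + y) z = cinner x z + cinner (y::'a::chilbert_space) z"
  by (metis cinner_add_right cinner_commute complex_cnj_add)

lemma cinner_scaleC_left: "cinner (a *\<^sub>C x) y = cnj a * cinner (x::'a::chilbert_space) y"
  by (metis cinner_commute cinner_scaleC_right complex_cnj_mult)

lemma cinner_scaleR_right: "cinner x (r *\<^sub>R y) = of_real r * cinner (x::'a::chilbert_space) y"
  by (metis cinner_scaleC_right scaleC_of_real)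

lemma cinner_scaleR_left: "cinner (r *\<^sub>R x) y = of_real r * cinner (x::'a::chilbert_space) y"
  by (metis cinner_scaleC_left scaleC_of_real complex_cnj_complex_of_real)

lemma cinner_minus_right: "cinner x (- y) = - cinner (x::'a::chilbert_space) y"
  using cinner_scaleR_right[of x "-1" y] by simp

lemma cinner_minus_left: "cinner (- x) y = - cinner (x::'a::chilbert_space) y"
  using cinner_scaleR_left[of "-1" x y] by simp

lemma cinner_diff_right: "cinner x (y - z) = cinner x y - cinner (x::'a::chilbert_space) z"
  using cinner_add_right[of x y "-z"] by (simp add: cinner_minus_right)

lemma cinner_diff_left: "cinner (x - y) z = cinner x z - cinner (y::'a::chilbert_space) z"
  using cinner_add_left[of x "-y" z] by (simp add: cinner_minus_left)

lemma cinner_zero_right [simp]: "cinner x 0 = 0"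
  using cinner_scaleR_right[of x 0 0] by simp

lemma cinner_zero_left [simp]: "cinner 0 x = 0"
  using cinner_scaleR_left[of 0 0 x] by simp

lemmas cinner_simps = cinner_add_left cinner_add_right cinner_diff_left cinner_diff_right
  cinner_minus_left cinner_minus_right cinner_scaleR_left cinner_scaleR_right
  cinner_scaleC_left cinner_scaleC_right

lemma cinner_sum_right: "cinner x (\<Sum>i\<in>I. f i) = (\<Sum>i\<in>I. cinner (x::'a::chilbert_space) (f i))"
  by (induction I rule: infinite_finite_induct) (auto simp: cinner_simps)

lemma Re_cinner_self: "Re (cinner x x) = (norm (x::'a::chilbert_space))\<^sup>2"
  by (simp add: cinner_self)

lemma cinner_eqI:
  fixes y z :: "'a::chilbert_space"
  assumes "\<And>x. cinner x y = cinner x z"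
  shows "y = z"
proof -
  have "cinner (y - z) (y - z) = 0"
    using assms[of "y - z"] by (simp add: cinner_diff_right)
  then show ?thesis by (simp add: cinner_self)
qed

text \<open>The squared norm of |y| x - |x| y is nonnegative; expanding it gives the bound.\<close>

lemma Re_cinner_le: "Re (cinner x y) \<le> norm x * norm (y::'a::chilbert_space)"
proof (cases "x = 0 \<or> y = 0")
  case False
  have e: "0 \<le> Re (cinner (norm y *\<^sub>R x - norm x *\<^sub>R y) (norm y *\<^sub>R x - norm x *\<^sub>R y))"
    by (simp add: Re_cinner_self)
  have c: "Re (cinner y x) = Re (cinner x y)" by (metis cinner_commute complex_cnj(1) complex.sel(1) complex_surj)
  from e have "0 \<le> norm y * norm x * (2 * (norm x * norm y) - 2 * Re (cinner x y))"
    by (simp add: cinner_simps c Re_cinner_self power2_eq_square algebra_simps)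
  moreover have "norm y * norm x > 0" using False by simp
  ultimately have "0 \<le> 2 * (norm x * norm y) - 2 * Re (cinner x y)"
    by (simp add: zero_le_mult_iff)
  then show ?thesis by simp
qed auto

lemma norm_cinner_le: "norm (cinner x y) \<le> norm x * norm (y::'a::chilbert_space)"
proof -
  have nC: "norm (a *\<^sub>C y) = norm a * norm y" for a
  proof -
    have "(norm (a *\<^sub>C y))\<^sup>2 = Re (cinner (a *\<^sub>C y) (a *\<^sub>C y))" by (simp add: Re_cinner_self)
    also have "cinner (a *\<^sub>C y) (a *\<^sub>C y) = (cnj a * a) * cinner y y"
      by (simp add: cinner_simps mult_ac)
    also have "\<dots> = of_real ((norm a * norm y)\<^sup>2)"
      by (metis cinner_self complex_norm_square mult.commute of_real_mult power_mult_distrib)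
    finally show ?thesis by (simp add: power2_eq_iff_nonneg)
  qed
  \<comment> \<open>The phase \<open>a\<close> turns \<open>cinner x y\<close> onto the nonnegative
    real axis, where the bound for the real part applies; it is 0 if the product vanishes.\<close>
  define a where "a = cnj (sgn (cinner x y))"
  have "norm (cinner x y) = Re (a * cinner x y)"
  proof -
    let ?z = "cinner x y"
    have "cnj (sgn ?z) * ?z = (?z * cnj ?z) / of_real (norm ?z)" by (simp add: sgn_eq)
    also have "\<dots> = of_real ((norm ?z)\<^sup>2) / of_real (norm ?z)" by (simp only: complex_norm_square)
    also have "\<dots> = of_real (norm ?z)" by (simp add: power2_eq_square)
    finally show ?thesis by (simp add: a_def)
  qed
  also have "\<dots> = Re (cinner x (a *\<^sub>C y))" by (simp add: cinner_simps)
  also have "\<dots> \<le> norm x * (norm a * norm y)" using Re_cinner_le[of x "a *\<^sub>C y"] by (simp add: nC)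
  also have "\<dots> \<le> norm x * norm y"
    by (simp add: a_def norm_sgn)
  finally show ?thesis .
qed

lemma tendsto_cinner:
  fixes f g :: "'b \<Rightarrow> 'a::chilbert_space"
  assumes "(f \<longlongrightarrow> x) F" "(g \<longlongrightarrow> y) F"
  shows "((\<lambda>n. cinner (f n) (g n)) \<longlongrightarrow> cinner x y) F"
proof -
  have b: "bounded_bilinear (cinner :: 'a \<Rightarrow> 'a \<Rightarrow> complex)"
  proof
    show "\<exists>K. \<forall>a b. norm (cinner a b) \<le> norm (a::'a) * norm (b::'a) * K"
      by (rule exI[of _ 1]) (simp add: norm_cinner_le)
  qed (simp_all add: cinner_simps scaleR_conv_of_real)
  show ?thesis by (rule bounded_bilinear.tendsto[OF b assms])
qed

subsection \<open>Hermitian bounded operators\<close>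

definition herm :: "('a::chilbert_space \<Rightarrow>\<^sub>L 'a) \<Rightarrow> bool" where
  "herm T \<longleftrightarrow> (\<forall>x y. cinner x (T y) = cinner (T x) y)"

definition quad :: "('a::chilbert_space \<Rightarrow>\<^sub>L 'a) \<Rightarrow> 'a \<Rightarrow> real" where
  "quad T x = Re (cinner x (T x))"

lemma hermD: "herm T \<Longrightarrow> cinner x (T y) = cinner (T x) y"
  by (simp add: herm_def)

text \<open>A \<open>blinfun\<close> is only real-linear; symmetry alone forces complex homogeneity,
  because both sides have the same inner product with every vector.\<close>

lemma herm_scaleC: "herm T \<Longrightarrow> T (a *\<^sub>C x) = a *\<^sub>C T x"
  by (rule cinner_eqI) (simp add: hermD cinner_simps)

lemma herm_clinear: "herm T \<Longrightarrow> clinear_on UNIV (blinfun_apply T)"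
  by (simp add: clinear_on_def blinfun.bilinear_simps herm_scaleC)

lemma herm_self_adjoint: "herm T \<Longrightarrow> self_adjoint UNIV (blinfun_apply T)"
  unfolding self_adjoint_def adjoint_maps_def
  by (auto simp: herm_clinear hermD) (metis cinner_eqI cinner_commute)

lemma self_adjoint_herm: "self_adjoint UNIV (blinfun_apply T) \<Longrightarrow> herm T"
  unfolding self_adjoint_def adjoint_maps_def herm_def by auto

lemma positive_operators_iff: "T \<in> positive_operators \<longleftrightarrow> herm T \<and> (\<forall>x. 0 \<le> quad T x)"
  by (auto simp: positive_operators_def quad_def herm_self_adjoint self_adjoint_herm)

lemma herm_id [simp]: "herm id_blinfun" by (simp add: herm_def)
lemma herm_zero [simp]: "herm 0" by (simp add: herm_def)
lemma herm_add: "herm S \<Longrightarrow> herm T \<Longrightarrow> herm (S + T)"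
  by (simp add: herm_def blinfun.bilinear_simps cinner_simps)
lemma herm_diff: "herm S \<Longrightarrow> herm T \<Longrightarrow> herm (S - T)"
  by (simp add: herm_def blinfun.bilinear_simps cinner_simps)
lemma herm_scaleR: "herm T \<Longrightarrow> herm (r *\<^sub>R T)"
  by (simp add: herm_def blinfun.bilinear_simps cinner_simps)
lemma herm_sum: "(\<And>i. i \<in> I \<Longrightarrow> herm (f i)) \<Longrightarrow> herm (\<Sum>i\<in>I. f i)"
  by (induction I rule: infinite_finite_induct) (auto intro: herm_add)

lemma herm_compose: "herm S \<Longrightarrow> herm T \<Longrightarrow> S o\<^sub>L T = T o\<^sub>L S \<Longrightarrow> herm (S o\<^sub>L T)"
  by (metis (no_types, lifting) blinfun_apply_blinfun_compose herm_def)

lemma herm_lim: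
  fixes T :: "nat \<Rightarrow> 'a::chilbert_space \<Rightarrow>\<^sub>L 'a" and S :: "'a \<Rightarrow>\<^sub>L 'a"
  assumes "\<And>n. herm (T n)" "\<And>x. (\<lambda>n. T n x) \<longlonglongrightarrow> S x"
  shows "herm S"
  unfolding herm_def
proof (intro allI)
  fix x y
  have "(\<lambda>n. cinner x (T n y)) \<longlonglongrightarrow> cinner x (S y)" "(\<lambda>n. cinner (T n x) y) \<longlonglongrightarrow> cinner (S x) y"
    by (intro tendsto_cinner assms tendsto_const)+
  then show "cinner x (S y) = cinner (S x) y"
    using assms(1) by (simp add: hermD LIMSEQ_unique)
qed

lemma cinner_herm_real: "herm T \<Longrightarrow> cinner x (T x) = of_real (quad T x)"
  unfolding quad_def
  by (metis cinner_commute hermD Reals_cnj_iff complex_is_Real_iff of_real_Re)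

lemma quad_add: "quad (S + T) x = quad S x + quad T x"
  and quad_diff: "quad (S - T) x = quad S x - quad T x"
  and quad_scaleR: "quad (r *\<^sub>R T) x = r * quad T x"
  and quad_id: "quad id_blinfun x = (norm x)\<^sup>2"
  and quad_zero: "quad 0 x = 0"
  by (simp_all add: quad_def blinfun.bilinear_simps cinner_simps Re_cinner_self)

lemma quad_sum: "quad (\<Sum>i\<in>I. f i) x = (\<Sum>i\<in>I. quad (f i) x)"
  by (induction I rule: infinite_finite_induct) (auto simp: quad_add quad_zero)

lemma abs_quad_le: "\<bar>quad T x\<bar> \<le> norm T * (norm x)\<^sup>2"
proof -
  have "\<bar>quad T x\<bar> \<le> norm (cinner x (T x))" unfolding quad_def by (rule abs_Re_le_cmod)
  also have "\<dots> \<le> norm x * norm (T x)" by (rule norm_cinner_le)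
  also have "\<dots> \<le> norm x * (norm T * norm x)" by (intro mult_left_mono norm_blinfun) simp
  finally show ?thesis by (simp add: power2_eq_square mult_ac)
qed

lemma quad_tendsto:
  fixes T :: "nat \<Rightarrow> 'a::chilbert_space \<Rightarrow>\<^sub>L 'a" and S :: "'a \<Rightarrow>\<^sub>L 'a"
  assumes "\<And>x. (\<lambda>n. T n x) \<longlonglongrightarrow> S x"
  shows "(\<lambda>n. quad (T n) x) \<longlonglongrightarrow> quad S x"
  unfolding quad_def by (intro tendsto_Re tendsto_cinner assms tendsto_const)

text \<open>What makes quadratic forms sufficient: equality, weak convergence and norm bounds of
  hermitian operators reduce to \<open>quad\<close> through this identity.\<close>

lemma polarization:
  assumes "herm T"
  shows "4 * cinner x (T y) = of_real (quad T (x + y) - quad T (x - y))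
     + \<i> * of_real (quad T (x - \<i> *\<^sub>C y) - quad T (x + \<i> *\<^sub>C y))"
  using assms
  by (simp add: cinner_herm_real[symmetric] herm_scaleC blinfun.bilinear_simps cinner_simps algebra_simps)

lemma herm_eqI:
  assumes "herm S" "herm T" "\<And>x. quad S x = quad T x"
  shows "S = T"
proof (rule blinfun_eqI, rule cinner_eqI)
  fix x y
  have "4 * cinner x (S y) = 4 * cinner x (T y)"
    using assms by (simp add: polarization)
  then show "cinner x (S y) = cinner x (T y)" by simp
qed

text \<open>The norm of a hermitian operator is its numerical radius. Polarization on unit vectors
  leaves two values of the form in the real part, and the parallelogram law adds their bounds up to
  4 c.\<close>

lemma herm_norm_le:
  assumes T: "herm T" and c: "\<And>x. \<bar>quad T x\<bar> \<le> c * (norm x)\<^sup>2" and "0 \<le> c"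
  shows "norm T \<le> c"
proof (rule norm_blinfun_bound[OF \<open>0 \<le> c\<close>])
  fix x
  have re: "Re (cinner x y) \<le> c" if "norm u = 1" "norm x = 1" "y = T u" for x u y
  proof -
    have "4 * Re (cinner x (T u)) = Re (4 * cinner x (T u))" by simp
    also have "\<dots> = quad T (x + u) - quad T (x - u)"
      by (subst polarization[OF T]) simp
    also have "\<dots> \<le> c * (norm (x + u))\<^sup>2 + c * (norm (x - u))\<^sup>2"
      using c[of "x+u"] c[of "x-u"] by linarith
    also have "\<dots> = c * (Re (cinner (x+u) (x+u)) + Re (cinner (x-u) (x-u)))"
      by (simp add: Re_cinner_self algebra_simps)
    also have "\<dots> = c * 4"
      using that by (simp add: cinner_simps Re_cinner_self algebra_simps)
    finally show ?thesis using that by simp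
  qed
  show "norm (T x) \<le> c * norm x"
  proof (cases "x = 0 \<or> T x = 0")
    case True
    then show ?thesis using \<open>0 \<le> c\<close> by (auto simp: blinfun.bilinear_simps)
  next
    case False
    let ?u = "x /\<^sub>R norm x" and ?v = "T x /\<^sub>R norm (T x)"
    have "Re (cinner ?v (T ?u)) \<le> c" by (rule re) (use False in auto)
    moreover have "Re (cinner ?v (T ?u)) = norm (T x) / norm x"
      using False by (simp add: blinfun.bilinear_simps cinner_simps Re_cinner_self power2_eq_square field_simps)
    ultimately show ?thesis using False by (simp add: field_simps)
  qed
qed

lemma strong_limit:
  fixes T :: "nat \<Rightarrow> 'a::chilbert_space \<Rightarrow>\<^sub>L 'a"
  assumes "\<And>n. norm (T n) \<le> C" "\<And>x. Cauchy (\<lambda>n. T n x)"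
  obtains S :: "'a \<Rightarrow>\<^sub>L 'a" where "\<And>x. (\<lambda>n. T n x) \<longlonglongrightarrow> S x"
proof -
  have "\<exists>s. \<forall>x. (\<lambda>n. T n x) \<longlonglongrightarrow> s x"
    by (rule choice) (use assms(2) in \<open>auto simp: Cauchy_convergent_iff convergent_def\<close>)
  then obtain s where s: "\<And>x. (\<lambda>n. T n x) \<longlonglongrightarrow> s x" by blast
  have "bounded_linear s"
  proof (rule bounded_linear_intro[where K=C])
    show "s (x + y) = s x + s y" for x y
    proof (rule LIMSEQ_unique[OF s])
      show "(\<lambda>n. T n (x + y)) \<longlonglongrightarrow> s x + s y"
        unfolding blinfun.add_right by (intro tendsto_add s)
    qed
    show "s (r *\<^sub>R x) = r *\<^sub>R s x" for r x
    proof (rule LIMSEQ_unique[OF s])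
      show "(\<lambda>n. T n (r *\<^sub>R x)) \<longlonglongrightarrow> r *\<^sub>R s x"
        unfolding blinfun.scaleR_right by (intro tendsto_scaleR tendsto_const s)
    qed
    show "norm (s x) \<le> norm x * C" for x
    proof (rule LIMSEQ_le_const2[OF tendsto_norm[OF s]], intro exI allI impI)
      fix n
      have "norm (T n x) \<le> norm (T n) * norm x" by (rule norm_blinfun)
      also have "\<dots> \<le> C * norm x" by (intro mult_right_mono assms) simp
      finally show "norm (T n x) \<le> norm x * C" by (simp add: mult.commute)
    qed
  qed
  then have "\<And>x. (\<lambda>n. T n x) \<longlonglongrightarrow> Blinfun s x"
    using s by (simp add: bounded_linear_Blinfun_apply)
  then show ?thesis by (rule that)
qed

lemma strong_limit_commute:
  fixes T :: "nat \<Rightarrow> 'a::chilbert_space \<Rightarrow>\<^sub>L 'a" and S B :: "'a \<Rightarrow>\<^sub>L 'a"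
  assumes "\<And>x. (\<lambda>n. T n x) \<longlonglongrightarrow> S x" "\<And>n. T n o\<^sub>L B = B o\<^sub>L T n"
  shows "S o\<^sub>L B = B o\<^sub>L S"
proof (rule blinfun_eqI)
  fix x
  have "(\<lambda>n. B (T n x)) \<longlonglongrightarrow> B (S x)"
    by (intro blinfun.tendsto assms tendsto_const)
  moreover have "(\<lambda>n. B (T n x)) = (\<lambda>n. T n (B x))"
    using assms(2) by (metis blinfun_apply_blinfun_compose)
  ultimately show "(S o\<^sub>L B) x = (B o\<^sub>L S) x"
    using assms(1)[of "B x"] LIMSEQ_unique by auto
qed

subsection \<open>Polynomials in an operator\<close>

primrec bpow :: "('a::chilbert_space \<Rightarrow>\<^sub>L 'a) \<Rightarrow> nat \<Rightarrow> ('a \<Rightarrow>\<^sub>L 'a)" where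
  "bpow A 0 = id_blinfun"
| "bpow A (Suc n) = A o\<^sub>L bpow A n"

definition pop :: "('a::chilbert_space \<Rightarrow>\<^sub>L 'a) \<Rightarrow> real poly \<Rightarrow> ('a \<Rightarrow>\<^sub>L 'a)" where
  "pop A p = (\<Sum>i\<le>degree p. coeff p i *\<^sub>R bpow A i)"

lemma pop_sum:
  assumes "degree p \<le> N"
  shows "pop A p = (\<Sum>i\<le>N. coeff p i *\<^sub>R bpow A i)"
  unfolding pop_def using assms
  by (intro sum.mono_neutral_left) (auto simp: coeff_eq_0)

lemma pop_0 [simp]: "pop A 0 = 0" by (simp add: pop_def)
lemma pop_1 [simp]: "pop A 1 = id_blinfun" by (simp add: pop_def)

lemma pop_add: "pop A (p + q) = pop A p + pop A q"
proof -
  let ?N = "max (degree p) (degree q)"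
  have "degree (p + q) \<le> ?N" by (rule degree_add_le) auto
  then show ?thesis by (simp add: pop_sum[of _ ?N] scaleR_add_left sum.distrib)
qed

lemma pop_smult: "pop A (smult c p) = c *\<^sub>R pop A p"
  using pop_sum[of "smult c p" "degree p" A] degree_smult_le[of c p]
  by (simp add: pop_def scaleR_sum_right)

lemma pop_minus: "pop A (- p) = - pop A p"
  using pop_smult[of A "-1" p] by simp

lemma pop_diff: "pop A (p - q) = pop A p - pop A q"
  using pop_add[of A p "-q"] by (simp add: pop_minus)

lemma pop_sum_poly: "pop A (\<Sum>i\<in>I. f i) = (\<Sum>i\<in>I. pop A (f i))"
  by (induction I rule: infinite_finite_induct) (auto simp: pop_add)

lemma pop_pCons: "pop A (pCons a p) = a *\<^sub>R id_blinfun + (A o\<^sub>L pop A p)"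
proof -
  have "pop A (pCons a p) = (\<Sum>i\<le>Suc (degree p). coeff (pCons a p) i *\<^sub>R bpow A i)"
    by (rule pop_sum) (simp add: degree_pCons_le)
  also have "\<dots> = a *\<^sub>R id_blinfun + (\<Sum>i\<le>degree p. coeff p i *\<^sub>R (A o\<^sub>L bpow A i))"
    by (simp add: sum.atMost_Suc_shift del: sum.atMost_Suc)
  also have "(\<Sum>i\<le>degree p. coeff p i *\<^sub>R (A o\<^sub>L bpow A i)) = A o\<^sub>L pop A p"
    by (simp add: pop_def bounded_bilinear.sum_right[OF bounded_bilinear_blinfun_compose]
        bounded_bilinear.scaleR_right[OF bounded_bilinear_blinfun_compose])
  finally show ?thesis .
qed

lemma pop_X: "pop A [:0, 1:] = A"
  by (simp add: pop_pCons blinfun_eqI blinfun.bilinear_simps)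

lemma pop_mult: "pop A (p * q) = pop A p o\<^sub>L pop A q"
  by (induction p rule: pCons_induct)
    (auto simp: pop_add pop_smult pop_pCons blinfun.bilinear_simps intro!: blinfun_eqI)

lemma pop_mult_apply: "pop A (p * q) x = pop A p (pop A q x)"
  by (simp add: pop_mult)

lemma pop_commute:
  assumes "A o\<^sub>L B = B o\<^sub>L A"
  shows "pop A p o\<^sub>L B = B o\<^sub>L pop A p"
proof -
  have AB: "A (B x) = B (A x)" for x using assms by (metis blinfun_apply_blinfun_compose)
  have "pop A p (B x) = B (pop A p x)" for x
    by (induction p rule: pCons_induct) (simp_all add: pop_pCons blinfun.bilinear_simps AB)
  then show ?thesis by (simp add: blinfun_eqI)
qed

lemma herm_pop:
  assumes "herm A"
  shows "herm (pop A p)"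
proof (induction p rule: pCons_induct)
  case (pCons a p)
  have "A o\<^sub>L pop A p = pop A p o\<^sub>L A" using pop_commute[of A A p] by simp
  then show ?case
    using pCons assms by (auto simp: pop_pCons intro!: herm_add herm_scaleR herm_compose)
qed simp

text \<open>One factor r(A) moves to the left of the inner product. Multiplication by a square
  therefore preserves positivity of the quadratic form.\<close>

lemma quad_pop_square:
  assumes "herm A"
  shows "quad (pop A (q * r\<^sup>2)) x = quad (pop A q) (pop A r x)"
proof -
  have "pop A (q * r\<^sup>2) x = pop A r (pop A q (pop A r x))"
    by (metis mult.commute mult.assoc pop_mult_apply power2_eq_square)
  then show ?thesis using herm_pop[OF assms] by (simp add: quad_def hermD)
qed

lemma norm_pop_square:
  assumes "herm A"
  shows "(norm (pop A r x))\<^sup>2 = quad (pop A (r\<^sup>2)) x"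
  using quad_pop_square[OF assms, of 1 r x] by (simp add: quad_id)

text \<open>Square roots of operators are avoided: by parity, the product is a square times one of
  1, X, Y = 1 - X and X Y.\<close>

lemma quad_pop_Bernstein_nonneg:
  assumes A: "herm A" "\<And>x. 0 \<le> quad A x" "\<And>x. quad A x \<le> (norm x)\<^sup>2"
  shows "0 \<le> quad (pop A ([:0,1:] ^ k * [:1,-1:] ^ m)) x"
proof -
  let ?X = "[:0,1:] :: real poly" and ?Y = "[:1,-1:] :: real poly"
  note sq = quad_pop_square[OF A(1)]
  have X: "0 \<le> quad (pop A ?X) y" for y using A by (simp add: pop_X)
  have Y: "0 \<le> quad (pop A ?Y) y" for y
  proof -
    have "?Y = 1 - ?X" by (simp add: one_pCons)
    then show ?thesis using A by (simp add: pop_X pop_diff quad_diff quad_id)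
  qed
  \<comment> \<open>Multiplication by X + Y = 1 turns the mixed product into two terms, each a
    positive factor times a square.\<close>
  have "?X * ?Y = ?Y * ?X\<^sup>2 + ?X * ?Y\<^sup>2" by (simp add: power2_eq_square)
  then have XY: "0 \<le> quad (pop A (?X * ?Y)) y" for y
    by (simp add: pop_add quad_add sq X Y del: mult_pCons_left mult_pCons_right)
  obtain i where i: "k = 2 * i \<or> k = 2 * i + 1" by (metis evenE oddE)
  obtain j where j: "m = 2 * j \<or> m = 2 * j + 1" by (metis evenE oddE)
  have e: "x ^ (2*i) * y ^ (2*j) = 1 * (x ^ i * y ^ j)\<^sup>2"
    "x ^ (2*i+1) * y ^ (2*j) = x * (x ^ i * y ^ j)\<^sup>2"
    "x ^ (2*i) * y ^ (2*j+1) = y * (x ^ i * y ^ j)\<^sup>2"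
    "x ^ (2*i+1) * y ^ (2*j+1) = (x * y) * (x ^ i * y ^ j)\<^sup>2" for x y :: "real poly"
    by (simp_all add: power_mult_distrib power_mult[symmetric] mult_ac)
  have one: "0 \<le> quad (pop A 1) y" for y by (simp add: quad_id)
  from i j show ?thesis
    by (elim disjE; simp only: e sq X Y XY one)
qed

subsection \<open>Bernstein polynomials of an operator\<close>

definition bernp :: "nat \<Rightarrow> nat \<Rightarrow> real poly" where
  "bernp n k = smult (of_nat (n choose k)) ([:0,1:] ^ k * [:1,-1:] ^ (n - k))"

text \<open>The Bernstein operator of order \<open>n\<close> applied to t^j. The recursion replaces
  sampling at k / n by multiplication by t plus t (1 - t) / n times the derivative, which exposes
  both the degree bound and the limit t^j.\<close>

primrec bern_moment :: "nat \<Rightarrow> nat \<Rightarrow> real poly" where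
  "bern_moment n 0 = 1"
| "bern_moment n (Suc j) = pCons 0 (bern_moment n j)
     + smult (1 / real n) ([:0,1,-1:] * pderiv (bern_moment n j))"

lemma sum_bernp: "(\<Sum>k\<le>n. bernp n k) = 1"
proof -
  have "[:0,1:] + [:1,-1:] = (1 :: real poly)" by (simp add: one_pCons)
  then have "1 = ([:0,1:] + [:1,-1::real:]) ^ n" by (simp only: power_one)
  also have "\<dots> = (\<Sum>k\<le>n. bernp n k)"
    by (subst binomial_ring) (simp add: bernp_def of_nat_poly mult.assoc)
  finally show ?thesis by simp
qed

lemma pderiv_sum: "pderiv (\<Sum>i\<in>I. f i) = (\<Sum>i\<in>I. pderiv (f i :: real poly))"
  by (induction I rule: infinite_finite_induct) (auto simp: pderiv_add)

lemma smult_sum_right: "smult c (\<Sum>i\<in>I. f i) = (\<Sum>i\<in>I. smult c (f i :: real poly))"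
  by (induction I rule: infinite_finite_induct) (auto simp: smult_add_right)

text \<open>The extra factor \<open>p\<close> keeps the exponent k - 1, truncated at k = 0, out of
  the formula.\<close>

lemma X_pderiv_power:
  fixes p :: "real poly"
  shows "p * pderiv (p ^ k) = smult (of_nat k) (p ^ k) * pderiv p"
proof (cases k)
  case (Suc m)
  show ?thesis unfolding Suc pderiv_power_Suc by (simp only: power_Suc mult_smult_left mult_smult_right mult_ac)
qed simp

text \<open>This is the logarithmic derivative k / t - (n - k) / (1 - t) of a Bernstein polynomial,
  cleared of denominators.\<close>

lemma pderiv_bernp:
  assumes "k \<le> n"
  shows "[:0,1,-1:] * pderiv (bernp n k) = [:of_nat k, - of_nat n:] * bernp n k"
proof -
  let ?X = "[:0,1:] :: real poly" and ?Y = "[:1,-1:] :: real poly"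
  have XY: "[:0,1,-1:] = ?X * ?Y" by simp
  have dX: "?X * pderiv (?X ^ k) = smult (of_nat k) (?X ^ k)"
    by (subst X_pderiv_power) (simp add: pderiv_pCons)
  have dY: "?Y * pderiv (?Y ^ (n-k)) = - smult (of_nat (n-k)) (?Y ^ (n-k))"
    by (subst X_pderiv_power) (simp add: pderiv_pCons)
  have "?X * ?Y * pderiv (?X ^ k * ?Y ^ (n-k))
     = (?X * pderiv (?X ^ k)) * ?Y * ?Y ^ (n-k) + (?Y * pderiv (?Y ^ (n-k))) * ?X * ?X ^ k"
    by (simp only: pderiv_mult) (simp only: algebra_simps)
  also have "\<dots> = (smult (of_nat k) ?Y - smult (of_nat (n-k)) ?X) * (?X ^ k * ?Y ^ (n-k))"
    unfolding dX dY
    by (simp only: algebra_simps mult_smult_left mult_smult_right mult_minus_left mult_minus_right)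
  also have "smult (of_nat k) ?Y - smult (of_nat (n-k)) ?X = [:of_nat k, - of_nat n:]"
    using assms by (simp add: of_nat_diff)
  finally show ?thesis
    unfolding bernp_def XY pderiv_smult by (simp only: mult_smult_right)
qed

text \<open>The induction step writes k / n as X + (k / n - X); by the derivative formula,
  multiplying \<open>bernp n k\<close> by the second summand yields the differential term of the
  recursion.\<close>

lemma bern_moment_eq:
  assumes "n > 0"
  shows "bern_moment n j = (\<Sum>k\<le>n. smult ((real k / real n) ^ j) (bernp n k))"
proof (induction j)
  case 0
  show ?case by (simp add: sum_bernp)
next
  case (Suc j)
  let ?c = "\<lambda>k. (real k / real n) ^ j"
  have "[:0,1,-1:] * pderiv (bern_moment n j)
      = (\<Sum>k\<le>n. smult (?c k) ([:0,1,-1:] * pderiv (bernp n k)))"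
    unfolding Suc by (simp only: pderiv_sum pderiv_smult sum_distrib_left mult_smult_right)
  also have "\<dots> = (\<Sum>k\<le>n. smult (?c k) ([:of_nat k, - of_nat n:] * bernp n k))"
    by (intro sum.cong refl) (simp only: pderiv_bernp atMost_iff)
  finally have d: "smult (1 / real n) ([:0,1,-1:] * pderiv (bern_moment n j))
      = (\<Sum>k\<le>n. smult (?c k) (smult (1 / real n) [:of_nat k, - of_nat n:] * bernp n k))"
    by (simp only: smult_sum_right) (simp only: smult_smult mult_smult_left mult_smult_right mult.commute)
  have m: "smult (1 / real n) [:of_nat k, - of_nat n:] = [:real k / real n, -1:]" for k
    using assms by simp
  have "pCons 0 (bern_moment n j) = [:0,1:] * bern_moment n j" by simp
  also have "\<dots> = (\<Sum>k\<le>n. smult (?c k) ([:0,1:] * bernp n k))"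
    unfolding Suc by (simp only: sum_distrib_left mult_smult_right)
  finally have "bern_moment n (Suc j)
      = (\<Sum>k\<le>n. smult (?c k) (([:0,1:] + [:real k / real n, -1:]) * bernp n k))"
    unfolding bern_moment.simps d m
    by (simp only: sum.distrib[symmetric] smult_add_right[symmetric] distrib_right[symmetric])
  also have "\<dots> = (\<Sum>k\<le>n. smult ((real k / real n) ^ Suc j) (bernp n k))"
    by (simp add: mult.commute)
  finally show ?case .
qed

text \<open>The derivative lowers the degree by one and the quadratic factor raises it by two;
  constants, whose derivative is 0, are treated apart. As the bound does not depend on
  \<open>n\<close>, convergence of coefficients becomes convergence in norm.\<close>

lemma degree_bern_moment: "degree (bern_moment n j) \<le> j"
proof (induction j)
  case (Suc j)
  have "degree ([:0,1,-1:] * pderiv (bern_moment n j)) \<le> Suc j"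
  proof (cases "degree (bern_moment n j)")
    case 0
    then have "pderiv (bern_moment n j) = 0" by (simp add: pderiv_eq_0_iff)
    then show ?thesis by simp
  next
    case (Suc m)
    then have "degree (pderiv (bern_moment n j)) = m" by (simp add: degree_pderiv)
    then show ?thesis
      using degree_mult_le[of "[:0,1,-1:]" "pderiv (bern_moment n j)"] Suc \<open>degree (bern_moment n j) \<le> j\<close>
      by simp
  qed
  then show ?case
    using Suc by (auto intro!: degree_add_le order_trans[OF degree_pCons_le] order_trans[OF degree_smult_le]
        simp del: mult_pCons_left)
qed simp

text \<open>Only the term with 1 / n distinguishes the recursion from multiplication by t, and its
  other factor has convergent coefficients.\<close>

lemma coeff_bern_moment_tendsto:
  "(\<lambda>n. coeff (bern_moment n j) i) \<longlonglongrightarrow> coeff (monom 1 j) i"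
proof (induction j arbitrary: i)
  case 0
  show ?case by simp
next
  case (Suc j)
  let ?b = "\<lambda>n. bern_moment n j"
  have p: "(\<lambda>n. coeff (pCons 0 (f n)) i) \<longlonglongrightarrow> coeff (pCons 0 g) i"
    if "\<And>i. (\<lambda>n. coeff (f n) i) \<longlonglongrightarrow> coeff g i" for f :: "nat \<Rightarrow> real poly" and g i
    using that by (cases i) simp_all
  have q: "[:0,1,-1:] * q = pCons 0 q - pCons 0 (pCons 0 q)" for q :: "real poly"
    by simp
  have d: "(\<lambda>n. coeff ([:0,1,-1:] * pderiv (?b n)) i) \<longlonglongrightarrow> coeff ([:0,1,-1:] * pderiv (monom 1 j)) i" for i
    unfolding q coeff_diff
    by (intro tendsto_diff p; simp only: coeff_pderiv; intro tendsto_mult tendsto_const Suc)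
  have "(\<lambda>n. coeff (pCons 0 (?b n)) i + (1 / real n) * coeff ([:0,1,-1:] * pderiv (?b n)) i)
     \<longlonglongrightarrow> coeff (pCons 0 (monom 1 j)) i + 0 * coeff ([:0,1,-1:] * pderiv (monom 1 j)) i"
    by (intro tendsto_add tendsto_mult lim_1_over_n d p Suc)
  then show ?case by (simp add: monom_Suc del: mult_pCons_left)
qed

lemma pop_bern_moment_tendsto:
  "(\<lambda>n. pop A (bern_moment n j)) \<longlonglongrightarrow> pop A (monom 1 j)"
proof -
  have "(\<lambda>n. \<Sum>i\<le>j. coeff (bern_moment n j) i *\<^sub>R bpow A i)
      \<longlonglongrightarrow> (\<Sum>i\<le>j. coeff (monom 1 j) i *\<^sub>R bpow A i)"
    by (intro tendsto_sum tendsto_scaleR tendsto_const coeff_bern_moment_tendsto)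
  moreover have "degree (monom (1::real) j) \<le> j" by (simp add: degree_monom_le)
  ultimately show ?thesis
    by (simp add: pop_sum[OF degree_bern_moment] pop_sum[of "monom 1 j" j])
qed

subsection \<open>The spectral measure of a vector\<close>

definition unit_op :: "('a::chilbert_space \<Rightarrow>\<^sub>L 'a) \<Rightarrow> bool" where
  "unit_op A \<longleftrightarrow> herm A \<and> (\<forall>x. 0 \<le> quad A x \<and> quad A x \<le> (norm x)\<^sup>2)"

definition vector_measure :: "('a::chilbert_space \<Rightarrow>\<^sub>L 'a) \<Rightarrow> 'a \<Rightarrow> real measure \<Rightarrow> bool" where
  "vector_measure A x M \<longleftrightarrow> finite_measure M \<and> sets M = sets borel \<and> (AE t in M. t \<in> {0..1}) \<and>
     (\<forall>p. (\<integral>t. poly p t \<partial>M) = quad (pop A p) x)"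

lemma poly_measurable [measurable]: "poly (p :: real poly) \<in> borel_measurable borel"
  by (intro borel_measurable_continuous_onI continuous_intros)

text \<open>The mass at k / n is <x, b(A) x> with b the Bernstein polynomial
  \<open>bernp n k\<close>. These masses are nonnegative and add up to 1, and the moments of the
  resulting measure are quadratic forms of \<open>bern_moment\<close>.\<close>

lemma vector_measure_exists_unit:
  assumes A: "unit_op A" and x: "norm x = 1"
  shows "\<exists>M. vector_measure A x M"
proof -
  define w where "w n k = quad (pop A (bernp n k)) x" for n k
  have w_nonneg: "0 \<le> w n k" for n k
    using A quad_pop_Bernstein_nonneg[of A k "n - k" x]
    by (simp add: w_def bernp_def pop_smult quad_scaleR unit_op_def)
  have w_moment: "(\<Sum>k\<le>n. w n k * (real k / real n) ^ j) = quad (pop A (bern_moment n j)) x" if "n > 0" for n j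
    by (simp add: bern_moment_eq[OF that] pop_sum_poly quad_sum pop_smult quad_scaleR w_def mult.commute)
  \<comment> \<open>From here on the order is \<open>Suc n\<close>, as the grid k / n makes no sense
    for n = 0.\<close>
  have w_sum: "(\<Sum>k\<le>Suc n. w (Suc n) k) = 1" for n
    using w_moment[of "Suc n" 0] x by (simp add: quad_id)
  have w_poly: "(\<lambda>n. \<Sum>k\<le>Suc n. w (Suc n) k * poly p (real k / real (Suc n))) \<longlonglongrightarrow> quad (pop A p) x" for p
  proof -
    have "(\<Sum>k\<le>Suc n. w (Suc n) k * poly p (real k / real (Suc n)))
        = (\<Sum>j\<le>degree p. coeff p j * quad (pop A (bern_moment (Suc n) j)) x)" for n
    proof -
      have "(\<Sum>k\<le>Suc n. w (Suc n) k * poly p (real k / real (Suc n)))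
        = (\<Sum>k\<le>Suc n. \<Sum>j\<le>degree p. coeff p j * (w (Suc n) k * (real k / real (Suc n)) ^ j))"
        unfolding poly_altdef sum_distrib_left by (simp only: mult_ac)
      also have "\<dots> = (\<Sum>j\<le>degree p. coeff p j * (\<Sum>k\<le>Suc n. w (Suc n) k * (real k / real (Suc n)) ^ j))"
        by (subst sum.swap) (simp only: sum_distrib_left)
      finally show ?thesis by (simp only: w_moment[OF zero_less_Suc])
    qed
    moreover have "(\<lambda>n. \<Sum>j\<le>degree p. coeff p j * quad (pop A (bern_moment (Suc n) j)) x)
        \<longlonglongrightarrow> (\<Sum>j\<le>degree p. coeff p j * quad (pop A (monom 1 j)) x)"
    proof (intro tendsto_sum tendsto_mult tendsto_const)
      fix j
      show "(\<lambda>n. quad (pop A (bern_moment (Suc n) j)) x) \<longlonglongrightarrow> quad (pop A (monom 1 j)) x"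
        by (rule LIMSEQ_Suc[OF quad_tendsto]) (intro blinfun.tendsto pop_bern_moment_tendsto tendsto_const)
    qed
    moreover have "(\<Sum>j\<le>degree p. coeff p j * quad (pop A (monom 1 j)) x) = quad (pop A p) x"
    proof -
      have "(\<Sum>j\<le>degree p. coeff p j * quad (pop A (monom 1 j)) x)
          = quad (pop A (\<Sum>j\<le>degree p. smult (coeff p j) (monom 1 j))) x"
        by (simp only: pop_sum_poly quad_sum pop_smult quad_scaleR)
      then show ?thesis by (simp add: smult_monom poly_as_sum_of_monoms)
    qed
    ultimately show ?thesis by simp
  qed
  define P where "P n = point_measure {..Suc n} (\<lambda>k. ennreal (w (Suc n) k))" for n
  define M where "M n = distr (P n) borel (\<lambda>k. real k / real (Suc n))" for n
  have "prob_space (P n)" for n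
    by (rule prob_spaceI)
      (simp add: P_def emeasure_point_measure_finite space_point_measure w_nonneg sum_ennreal w_sum
        del: sum.atMost_Suc)
  moreover have meas: "(\<lambda>k. real k / real (Suc n)) \<in> borel_measurable (P n)" for n
    by (simp add: P_def)
  ultimately have rd: "real_distribution (M n)" for n
    unfolding M_def by (intro prob_space.real_distribution_distr)
  have int_M: "(\<integral>t. f t \<partial>M n) = (\<Sum>k\<le>Suc n. w (Suc n) k * f (real k / real (Suc n)))"
    if "f \<in> borel_measurable borel" for f :: "real \<Rightarrow> real" and n
    unfolding M_def by (subst integral_distr[OF meas that])
      (simp add: P_def lebesgue_integral_point_measure_finite w_nonneg del: sum.atMost_Suc)
  \<comment> \<open>Tightness speaks of intervals open on the left; starting at -1 keeps the atom at
    0 inside.\<close>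
  have M1: "measure (M n) {-1<..1} = 1" for n
  proof -
    interpret real_distribution "M n" by (rule rd)
    have "measure (M n) {-1<..1} = (\<integral>t. indicator {-1<..1} t \<partial>M n)" by simp
    also have "\<dots> = (\<Sum>k\<le>Suc n. w (Suc n) k * indicator {-1<..1} (real k / real (Suc n)))"
      by (rule int_M) simp
    also have "\<dots> = (\<Sum>k\<le>Suc n. w (Suc n) k)"
      by (intro sum.cong refl) (auto simp: indicator_def divide_le_eq_1 less_divide_eq)
    finally show ?thesis by (simp only: w_sum)
  qed
  have "tight M"
    unfolding tight_def
  proof (intro conjI allI impI rd)
    fix e :: real
    assume "e > 0"
    then show "\<exists>a b. a < b \<and> (\<forall>n. measure (M n) {a<..b} > 1 - e)"
      by (intro exI[of _ "-1"] exI[of _ 1]) (simp add: M1)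
  qed
  from tight_imp_convergent_subsubsequence[OF this strict_mono_id]
  obtain r N where r: "strict_mono r" and N: "real_distribution N" and "weak_conv_m (M \<circ> id \<circ> r) N"
    by (auto simp: id_def)
  then have wc: "weak_conv_m (\<lambda>n. M (r n)) N" by (simp add: comp_def)
  interpret N: real_distribution N by fact
  have lim: "(\<lambda>n. \<integral>t. f t \<partial>M (r n)) \<longlonglongrightarrow> (\<integral>t. f t \<partial>N)"
    if "\<And>t. isCont f t" "\<And>t. norm (f t) \<le> B" for f :: "real \<Rightarrow> real" and B
    by (rule weak_conv_imp_integral_bdd_continuous_conv[OF rd N wc that])
  \<comment> \<open>Weak convergence tests bounded functions only. Composition with the clamp
    \<open>c\<close> makes a polynomial bounded without changing it on the unit interval, which
    contains the grid and, as shown next, carries \<open>N\<close>.\<close>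
  define c where "c t = max 0 (min 1 t)" for t :: real
  have c01: "c t \<in> {0..1}" for t by (auto simp: c_def)
  have c_id: "c t = t" if "t \<in> {0..1}" for t using that by (auto simp: c_def)
  have c_cont: "isCont c t" for t unfolding c_def by (intro continuous_intros)
  have ck: "c (real k / real (Suc n)) = real k / real (Suc n)" if "k \<le> Suc n" for k n
    using that by (intro c_id) (auto simp: divide_le_eq_1)
  have AE: "AE t in N. t \<in> {0..1}"
  proof -
    \<comment> \<open>A bounded continuous function that vanishes exactly on the unit
      interval.\<close>
    let ?g = "\<lambda>t. min 1 \<bar>t - c t\<bar>"
    have g: "isCont ?g t" for t by (intro continuous_intros c_cont)
    then have gm: "?g \<in> borel_measurable borel"
      by (intro borel_measurable_continuous_onI continuous_at_imp_continuous_on) auto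
    have "(\<lambda>n. \<integral>t. ?g t \<partial>M (r n)) \<longlonglongrightarrow> (\<integral>t. ?g t \<partial>N)"
      by (rule lim[OF g, of 1]) auto
    moreover have "(\<integral>t. ?g t \<partial>M n) = 0" for n
      unfolding int_M[OF gm] by (intro sum.neutral) (auto simp: ck simp del: of_nat_Suc)
    ultimately have "(\<lambda>n. 0) \<longlonglongrightarrow> (\<integral>t. ?g t \<partial>N)" by (simp only:)
    then have "(\<integral>t. ?g t \<partial>N) = 0" unfolding LIMSEQ_const_iff by (rule sym)
    moreover have "integrable N ?g"
      by (rule N.integrable_const_bound[of _ 1]) (use gm in \<open>auto simp: N.M_is_borel\<close>)
    ultimately have "AE t in N. ?g t = 0"
      by (subst (asm) integral_nonneg_eq_0_iff_AE) auto
    then show ?thesis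
      by (rule AE_mp) (auto intro!: AE_I2 simp: c_def min_def max_def split: if_splits)
  qed
  have "(\<integral>t. poly p t \<partial>N) = quad (pop A p) x" for p
  proof -
    have pc: "isCont (\<lambda>t. poly p (c t)) t" for t
      by (intro isCont_o2[OF c_cont] poly_isCont)
    then have pm: "(\<lambda>t. poly p (c t)) \<in> borel_measurable borel"
      by (intro borel_measurable_continuous_onI continuous_at_imp_continuous_on) auto
    have "bounded (poly p ` {0..1})"
      by (intro compact_imp_bounded compact_continuous_image continuous_intros) auto
    then obtain B where "\<And>t. t \<in> {0..1} \<Longrightarrow> norm (poly p t) \<le> B"
      unfolding bounded_iff by blast
    then have "(\<lambda>n. \<integral>t. poly p (c t) \<partial>M (r n)) \<longlonglongrightarrow> (\<integral>t. poly p (c t) \<partial>N)"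
      using c01 by (intro lim[OF pc]) blast
    moreover have "(\<integral>t. poly p (c t) \<partial>M n)
        = (\<Sum>k\<le>Suc n. w (Suc n) k * poly p (real k / real (Suc n)))" for n
      unfolding int_M[OF pm] by (intro sum.cong refl) (simp only: ck atMost_iff)
    ultimately have "(\<integral>t. poly p (c t) \<partial>N) = quad (pop A p) x"
      using LIMSEQ_subseq_LIMSEQ[OF w_poly[of p] r] by (simp add: comp_def LIMSEQ_unique)
    moreover have "(\<integral>t. poly p (c t) \<partial>N) = (\<integral>t. poly p t \<partial>N)"
      by (intro integral_cong_AE) (use AE pm in \<open>auto simp: c_id elim!: AE_mp\<close>)
    ultimately show ?thesis by simp
  qed
  then show ?thesis
    unfolding vector_measure_def using AE N.finite_measure_axioms N.events_eq_borel by blast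
qed

lemma vector_measure_exists:
  fixes A :: "'a::chilbert_space \<Rightarrow>\<^sub>L 'a"
  assumes A: "unit_op A"
  shows "\<exists>M. vector_measure A x M"
proof (cases "x = 0")
  case True
  have "vector_measure A x (null_measure borel)"
    unfolding vector_measure_def
    by (auto simp: True quad_def intro!: finite_measureI AE_I[of _ _ UNIV])
  then show ?thesis ..
next
  case False
  define u where "u = x /\<^sub>R norm x"
  have "norm u = 1" using False by (simp add: u_def)
  then obtain M where M: "vector_measure A u M" using vector_measure_exists_unit[OF A] by blast
  interpret M: finite_measure M using M by (simp add: vector_measure_def)
  have sM [measurable_cong]: "sets M = sets borel" using M by (simp add: vector_measure_def)
  let ?c = "(norm x)\<^sup>2"
  let ?N = "density M (\<lambda>_. ennreal ?c)"
  have "quad (pop A p) x = ?c * quad (pop A p) u" for p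
    using False by (simp add: u_def quad_def blinfun.bilinear_simps cinner_simps power2_eq_square)
  moreover have "(\<integral>t. poly p t \<partial>?N) = ?c * (\<integral>t. poly p t \<partial>M)" for p
    by (subst integral_density) auto
  moreover have "finite_measure ?N"
    by (rule finite_measureI) (simp add: emeasure_density nn_integral_cmult ennreal_mult_eq_top_iff M.emeasure_finite)
  moreover have "AE t in ?N. t \<in> {0..1}"
    using M by (subst AE_density) (auto simp: vector_measure_def elim!: AE_mp)
  ultimately have "vector_measure A x ?N"
    using M by (simp add: vector_measure_def)
  then show ?thesis ..
qed

subsection \<open>Operator measures\<close>

lemma
  assumes "povm E"
  shows povm_herm: "\<Delta> \<in> sets borel \<Longrightarrow> herm (E \<Delta>)"
    and povm_nonneg: "\<Delta> \<in> sets borel \<Longrightarrow> 0 \<le> quad (E \<Delta>) x"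
  using assms by (auto simp: povm_def positive_operators_iff)

lemma povm_sums:
  assumes "povm E" "range \<Delta> \<subseteq> sets borel" "disjoint_family \<Delta>"
  shows "(\<lambda>n::nat. quad (E (\<Delta> n)) x) sums quad (E (\<Union>n. \<Delta> n)) x"
  using assms sums_Re unfolding povm_def quad_def by blast

lemma povm_empty:
  assumes "povm E"
  shows "E {} = 0"
proof (rule herm_eqI)
  fix x
  have "(\<lambda>n::nat. quad (E {}) x) sums quad (E {}) x"
    using povm_sums[OF assms, of "\<lambda>_. {}" x] by (auto simp: disjoint_family_on_def)
  then have "summable (\<lambda>n::nat. quad (E {}) x)" by (rule sums_summable)
  then show "quad (E {}) x = quad 0 x" by (simp add: summable_const_iff quad_zero)
qed (use povm_herm[OF assms] in auto)

lemma sets_scalar_measure [simp, measurable_cong]: "sets (scalar_measure E x) = sets borel"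
  unfolding scalar_measure_def
  by (subst sets_measure_of) (auto simp: sets.sigma_sets_eq[of borel, simplified])

lemma space_scalar_measure [simp]: "space (scalar_measure E x) = UNIV"
  unfolding scalar_measure_def by (subst space_measure_of) auto

lemma emeasure_scalar_measure:
  assumes E: "povm E" and \<Delta>: "\<Delta> \<in> sets borel"
  shows "emeasure (scalar_measure E x) \<Delta> = ennreal (quad (E \<Delta>) x)"
proof -
  have "emeasure (scalar_measure E x) \<Delta> = ennreal (Re (cinner x (E \<Delta> x)))"
  proof (rule emeasure_measure_of[OF scalar_measure_def])
    show "positive (sets (scalar_measure E x)) (\<lambda>\<Delta>. ennreal (Re (cinner x (E \<Delta> x))))"
      by (simp add: positive_def povm_empty[OF E])
    show "countably_additive (sets (scalar_measure E x)) (\<lambda>\<Delta>. ennreal (Re (cinner x (E \<Delta> x))))"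
      unfolding countably_additive_def quad_def[symmetric] sets_scalar_measure
    proof (intro allI impI)
      fix A :: "nat \<Rightarrow> real set"
      assume A: "range A \<subseteq> sets borel" "disjoint_family A"
      have "0 \<le> quad (E (A i)) x" for i using povm_nonneg[OF E] A by auto
      then show "(\<Sum>i. ennreal (quad (E (A i)) x)) = ennreal (quad (E (\<Union>i. A i)) x)"
        by (intro suminf_ennreal_eq povm_sums[OF E A])
    qed
  qed (use \<Delta> in auto)
  then show ?thesis by (simp add: quad_def)
qed

lemma measure_scalar_measure:
  assumes "povm E" "\<Delta> \<in> sets borel"
  shows "measure (scalar_measure E x) \<Delta> = quad (E \<Delta>) x"
  by (simp add: measure_def emeasure_scalar_measure[OF assms] povm_nonneg[OF assms])

lemma finite_scalar_measure:
  assumes "povm E"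
  shows "finite_measure (scalar_measure E x)"
  by (rule finite_measureI) (simp add: emeasure_scalar_measure[OF assms])

subsection \<open>Spectral projections\<close>

definition vmeas :: "('a::chilbert_space \<Rightarrow>\<^sub>L 'a) \<Rightarrow> 'a \<Rightarrow> real measure" where
  "vmeas A x = (SOME M. vector_measure A x M)"

text \<open>A spectral projection is pinned down by its quadratic form, which has to reproduce the
  chosen measures for all x at once. The last clause places it in the double commutant of
  \<open>A\<close>; this later makes the digits of commuting operators commute.\<close>

definition specproj :: "('a::chilbert_space \<Rightarrow>\<^sub>L 'a) \<Rightarrow> real set \<Rightarrow> ('a \<Rightarrow>\<^sub>L 'a) \<Rightarrow> bool" where
  "specproj A B P \<longleftrightarrow> herm P \<and> P o\<^sub>L P = P \<and> (\<forall>x. quad P x = measure (vmeas A x) B) \<and>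
     (\<forall>S. A o\<^sub>L S = S o\<^sub>L A \<longrightarrow> P o\<^sub>L S = S o\<^sub>L P)"

lemma quad_compose_self:
  assumes "herm P"
  shows "quad (P o\<^sub>L P) x = (norm (P x))\<^sup>2"
proof -
  have "quad (P o\<^sub>L P) x = Re (cinner x (P (P x)))" by (simp add: quad_def)
  also have "\<dots> = (norm (P x))\<^sup>2" by (subst hermD[OF assms]) (rule Re_cinner_self)
  finally show ?thesis .
qed

lemma quad_idempotent:
  assumes "herm P" "P o\<^sub>L P = P"
  shows "quad P x = (norm (P x))\<^sup>2"
  using quad_compose_self[OF assms(1), of x] assms(2) by simp

lemma idempotentI:
  assumes "herm P" "\<And>x. quad P x = (norm (P x))\<^sup>2"
  shows "P o\<^sub>L P = P"
  by (rule herm_eqI) (use assms in \<open>auto intro: herm_compose simp: quad_compose_self\<close>)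

lemma poly_bernp: "poly (bernp n k) t = Bernstein n k t"
  by (simp add: bernp_def Bernstein_def)

lemma Weierstrass_poly:
  fixes f :: "real \<Rightarrow> real"
  assumes "continuous_on {0..1} f" "0 < e"
  shows "\<exists>p. \<forall>t\<in>{0..1}. \<bar>f t - poly p t\<bar> < e"
proof -
  obtain n where n: "\<bar>f t - (\<Sum>k\<le>n. f (k / n) * Bernstein n k t)\<bar> < e" if "t \<in> {0..1}" for t
    using Bernstein_Weierstrass[OF assms] by blast
  have "poly (\<Sum>k\<le>n. smult (f (k / n)) (bernp n k)) t = (\<Sum>k\<le>n. f (k / n) * Bernstein n k t)" for t
    by (simp add: poly_sum poly_bernp)
  then show ?thesis using n by (intro exI[of _ "\<Sum>k\<le>n. smult (f (k / n)) (bernp n k)"]) simp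
qed

context
  fixes A :: "'a::chilbert_space \<Rightarrow>\<^sub>L 'a"
  assumes A: "unit_op A"
begin

lemma vmeas: "vector_measure A x (vmeas A x)"
  unfolding vmeas_def by (rule someI_ex[OF vector_measure_exists[OF A]])

lemma sets_vmeas [simp, measurable_cong]: "sets (vmeas A x) = sets borel"
  using vmeas[of x] by (simp add: vector_measure_def)

lemma space_vmeas [simp]: "space (vmeas A x) = UNIV"
  using sets_eq_imp_space_eq[OF sets_vmeas] by simp

lemma vmeas_finite: "finite_measure (vmeas A x)"
  using vmeas[of x] by (simp add: vector_measure_def)

lemma vmeas_AE: "AE t in vmeas A x. t \<in> {0..1}"
  using vmeas[of x] by (simp add: vector_measure_def)

lemma vmeas_poly: "(\<integral>t. poly p t \<partial>vmeas A x) = quad (pop A p) x"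
  using vmeas[of x] by (simp add: vector_measure_def)

lemma herm_A: "herm A" using A by (simp add: unit_op_def)

lemma vmeas_UNIV: "measure (vmeas A x) UNIV = (norm x)\<^sup>2"
  using vmeas_poly[where p=1 and x=x] by (simp add: quad_id)

text \<open>p \<mapsto> p(A) x is an isometry from the polynomials in L2 of
  \<open>vmeas A x\<close>; convergence of functions becomes strong convergence of
  operators.\<close>

lemma norm_pop: "(norm (pop A p x))\<^sup>2 = (\<integral>t. (poly p t)\<^sup>2 \<partial>vmeas A x)"
  using norm_pop_square[OF herm_A, of p x] by (simp flip: vmeas_poly)

lemma vmeas_integrable:
  fixes f :: "real \<Rightarrow> real"
  assumes "f \<in> borel_measurable borel" "\<And>t. t \<in> {0..1} \<Longrightarrow> \<bar>f t\<bar> \<le> C"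
  shows "integrable (vmeas A x) f"
proof -
  interpret finite_measure "vmeas A x" by (rule vmeas_finite)
  show ?thesis
    by (rule integrable_const_bound[of _ C]) (use vmeas_AE[of x] assms in \<open>auto elim!: AE_mp\<close>)
qed

lemma norm_pop_le:
  assumes "\<And>t. t \<in> {0..1} \<Longrightarrow> \<bar>poly p t\<bar> \<le> C"
  shows "norm (pop A p) \<le> C"
proof (rule norm_blinfun_bound)
  show C: "0 \<le> C" using assms[of 0] by auto
  fix x
  interpret finite_measure "vmeas A x" by (rule vmeas_finite)
  have sq: "(poly p t)\<^sup>2 \<le> C\<^sup>2" if "t \<in> {0..1}" for t
    using power_mono[OF assms[OF that], of 2] by simp
  have "(norm (pop A p x))\<^sup>2 \<le> (\<integral>t. C\<^sup>2 \<partial>vmeas A x)"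
    unfolding norm_pop
    by (rule integral_mono_AE)
      (use vmeas_AE[of x] sq in \<open>auto intro!: vmeas_integrable[of _ "C\<^sup>2"] elim!: AE_mp\<close>)
  also have "\<dots> = (C * norm x)\<^sup>2" by (simp add: vmeas_UNIV power_mult_distrib)
  finally show "norm (pop A p x) \<le> C * norm x"
    using C by (simp add: power2_le_iff_abs_le)
qed

text \<open>Dominated convergence makes the polynomials Cauchy in every L2, hence the operators
  strongly Cauchy. As an indicator is its own square, the limit P satisfies |P x|^2 = <x, P x> and
  so is idempotent.\<close>

lemma specproj_limit:
  assumes bd: "\<And>n t. t \<in> {0..1} \<Longrightarrow> \<bar>poly (q n) t\<bar> \<le> C"
    and lim: "\<And>t. t \<in> {0..1} \<Longrightarrow> (\<lambda>n. poly (q n) t) \<longlonglongrightarrow> indicator B t"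
    and B: "B \<in> sets borel"
  shows "\<exists>P. specproj A B P"
proof -
  have C: "0 \<le> C" using order_trans[OF abs_ge_zero bd[of 0 0]] by simp
  \<comment> \<open>\<open>g\<close> is a parameter because the same convergence serves (a - b)^2,
    a^2 and a.\<close>
  have dct: "(\<lambda>n. \<integral>t. g (poly (q n) t) (indicator B t) \<partial>vmeas A x) \<longlonglongrightarrow> (\<integral>t. g (indicator B t) (indicator B t) \<partial>vmeas A x)"
    if g: "continuous_on UNIV (\<lambda>z. g (fst z) (snd z))" for g :: "real \<Rightarrow> real \<Rightarrow> real" and x
  proof -
    interpret finite_measure "vmeas A x" by (rule vmeas_finite)
    have "compact ((\<lambda>z. g (fst z) (snd z)) ` ({-C..C} \<times> {0..1}))"
      by (intro compact_continuous_image compact_Times continuous_on_subset[OF g]) auto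
    from compact_imp_bounded[OF this]
    obtain K where K: "\<And>a b. a \<in> {-C..C} \<Longrightarrow> b \<in> {0..1} \<Longrightarrow> \<bar>g a b\<bar> \<le> K"
      unfolding bounded_iff by fastforce
    show ?thesis
    proof (rule integral_dominated_convergence[where w="\<lambda>_. K"])
      show "AE t in vmeas A x. (\<lambda>n. g (poly (q n) t) (indicator B t)) \<longlonglongrightarrow> g (indicator B t) (indicator B t)"
        using vmeas_AE[of x]
      proof (rule AE_mp, intro AE_I2 impI)
        fix t :: real assume t: "t \<in> {0..1}"
        have "(\<lambda>n. (poly (q n) t, indicator B t :: real)) \<longlonglongrightarrow> (indicator B t, indicator B t)"
          by (intro tendsto_Pair lim t tendsto_const)
        from continuous_on_tendsto_compose[OF g this]
        show "(\<lambda>n. g (poly (q n) t) (indicator B t)) \<longlonglongrightarrow> g (indicator B t) (indicator B t)" by simp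
      qed
      show "AE t in vmeas A x. norm (g (poly (q n) t) (indicator B t)) \<le> K" for n
        using vmeas_AE[of x]
      proof (rule AE_mp, intro AE_I2 impI)
        fix t :: real assume "t \<in> {0..1}"
        then show "norm (g (poly (q n) t) (indicator B t)) \<le> K"
          using K[of "poly (q n) t" "indicator B t"] bd[of t n] by (auto simp: indicator_def abs_le_iff)
      qed
    qed (use B in \<open>auto intro!: borel_measurable_continuous_Pair[OF _ _ g]\<close>)
  qed
  have Cauchy: "Cauchy (\<lambda>n. pop A (q n) x)" for x
  proof -
    define d where "d n = (\<integral>t. (poly (q n) t - indicator B t)\<^sup>2 \<partial>vmeas A x)" for n
    have d0: "d \<longlonglongrightarrow> 0"
      using dct[of "\<lambda>a b. (a - b)\<^sup>2" x] unfolding d_def by (simp add: continuous_intros)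
    have b: "\<bar>(poly (q k) t - b)\<^sup>2\<bar> \<le> (2 * C + 1)\<^sup>2" if "t \<in> {0..1}" "\<bar>b\<bar> \<le> C + 1" for k t b
      using bd[OF that(1), of k] that(2) C by (subst abs_power2, subst power2_le_iff_abs_le) auto
    have i: "integrable (vmeas A x) (\<lambda>t. (poly (q k) t - indicator B t)\<^sup>2)" for k
      by (rule vmeas_integrable[OF _ b]) (use B C in \<open>auto simp: indicator_def\<close>)
    have dd: "(norm (pop A (q n) x - pop A (q m) x))\<^sup>2 \<le> 2 * d n + 2 * d m" for n m
    proof -
      have "(norm (pop A (q n) x - pop A (q m) x))\<^sup>2 = (\<integral>t. (poly (q n) t - poly (q m) t)\<^sup>2 \<partial>vmeas A x)"
        using norm_pop[of "q n - q m" x] by (simp add: pop_diff blinfun.bilinear_simps)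
      also have "\<dots> \<le> (\<integral>t. 2 * (poly (q n) t - indicator B t)\<^sup>2 + 2 * (poly (q m) t - indicator B t)\<^sup>2 \<partial>vmeas A x)"
      proof (rule integral_mono)
        show "integrable (vmeas A x) (\<lambda>t. 2 * (poly (q n) t - indicator B t)\<^sup>2 + 2 * (poly (q m) t - indicator B t)\<^sup>2)"
          using i by simp
        show "integrable (vmeas A x) (\<lambda>t. (poly (q n) t - poly (q m) t)\<^sup>2)"
          by (rule vmeas_integrable[OF _ b]) (use bd[of _ m] in \<open>force+\<close>)
        show "(poly (q n) t - poly (q m) t)\<^sup>2 \<le> 2 * (poly (q n) t - indicator B t)\<^sup>2 + 2 * (poly (q m) t - indicator B t)\<^sup>2" for t
        proof -
          have "(a - b)\<^sup>2 \<le> 2 * (a - c)\<^sup>2 + 2 * (b - c)\<^sup>2" for a b c :: real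
            using zero_le_power2[of "a + b - 2 * c"] by (simp add: power2_eq_square algebra_simps)
          then show ?thesis .
        qed
      qed
      also have "\<dots> = 2 * d n + 2 * d m"
      proof -
        show ?thesis unfolding d_def by (subst Bochner_Integration.integral_add) (use i in auto)
      qed
      finally show ?thesis .
    qed
    show ?thesis
    proof (rule metric_CauchyI)
      fix e :: real assume e: "e > 0"
      then have "eventually (\<lambda>n. \<bar>d n\<bar> < e\<^sup>2 / 4) sequentially"
        using order_tendstoD(2)[OF tendsto_rabs_zero[OF d0], of "e\<^sup>2/4"] by simp
      then obtain N where N: "\<And>n. n \<ge> N \<Longrightarrow> \<bar>d n\<bar> < e\<^sup>2 / 4"
        by (auto simp: eventually_sequentially)
      have "dist (pop A (q m) x) (pop A (q n) x) < e" if "m \<ge> N" "n \<ge> N" for m n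
      proof -
        have "(norm (pop A (q m) x - pop A (q n) x))\<^sup>2 < e\<^sup>2"
          using dd[of m n] N[OF that(1)] N[OF that(2)] by linarith
        then show ?thesis using e by (simp add: dist_norm power_less_imp_less_base)
      qed
      then show "\<exists>M. \<forall>m\<ge>M. \<forall>n\<ge>M. dist (pop A (q m) x) (pop A (q n) x) < e" by blast
    qed
  qed
  obtain P where P: "\<And>x. (\<lambda>n. pop A (q n) x) \<longlonglongrightarrow> blinfun_apply P x"
    using strong_limit[OF norm_pop_le[OF bd] Cauchy] by blast
  have h: "herm P" by (rule herm_lim[OF herm_pop[OF herm_A] P])
  have sq: "(norm (P x))\<^sup>2 = measure (vmeas A x) B" for x
  proof (rule LIMSEQ_unique)
    show "(\<lambda>n. (norm (pop A (q n) x))\<^sup>2) \<longlonglongrightarrow> (norm (P x))\<^sup>2"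
      by (intro tendsto_intros P)
    have "(indicator B t :: real)\<^sup>2 = indicator B t" for t by (simp add: indicator_def)
    then show "(\<lambda>n. (norm (pop A (q n) x))\<^sup>2) \<longlonglongrightarrow> measure (vmeas A x) B"
      using dct[of "\<lambda>a b. a\<^sup>2" x] unfolding norm_pop by (simp add: continuous_intros)
  qed
  have q: "quad P x = measure (vmeas A x) B" for x
  proof (rule LIMSEQ_unique)
    show "(\<lambda>n. quad (pop A (q n)) x) \<longlonglongrightarrow> quad P x" by (rule quad_tendsto[OF P])
    show "(\<lambda>n. quad (pop A (q n)) x) \<longlonglongrightarrow> measure (vmeas A x) B"
      using dct[of "\<lambda>a b. a" x] by (simp add: continuous_intros vmeas_poly)
  qed
  have "P o\<^sub>L P = P" by (rule idempotentI[OF h]) (simp add: sq q)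
  moreover have "P o\<^sub>L S = S o\<^sub>L P" if "A o\<^sub>L S = S o\<^sub>L A" for S
    by (rule strong_limit_commute[OF P pop_commute[OF that]])
  ultimately show ?thesis using h q unfolding specproj_def by blast
qed

lemma specproj_atMost: "\<exists>P. specproj A {..a} P"
proof -
  \<comment> \<open>Equal to 1 up to \<open>a\<close>, then falling to 0 with slope n: the pointwise
    limit is the indicator of the closed half-line.\<close>
  define f where "f n t = max 0 (1 - real n * max 0 (t - a))" for n t
  have "\<exists>p. \<forall>t\<in>{0..1}. \<bar>f n t - poly p t\<bar> < 1 / real (Suc n)" for n
    by (rule Weierstrass_poly) (auto simp: f_def intro!: continuous_intros)
  then obtain q where q: "\<And>n t. t \<in> {0..1} \<Longrightarrow> \<bar>f n t - poly (q n) t\<bar> < 1 / real (Suc n)" by metis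
  have f01: "0 \<le> f n t" "f n t \<le> 1" for n t by (auto simp: f_def)
  have "1 / real (Suc n) \<le> 1" for n by simp
  then have bd: "\<bar>poly (q n) t\<bar> \<le> 2" if "t \<in> {0..1}" for n t
    using q[OF that, of n] f01[of n t] by (smt (verit))
  have flim: "(\<lambda>n. f n t) \<longlonglongrightarrow> indicator {..a} t" for t
  proof (cases "t \<le> a")
    case True
    then show ?thesis by (simp add: f_def)
  next
    case False
    obtain N where N: "real N * (t - a) > 1"
      using reals_Archimedean3[of "t - a"] False by (auto simp: mult.commute)
    have "f n t = 0" if "n \<ge> N" for n
    proof -
      have "real N * (t - a) \<le> real n * (t - a)" using that False by (intro mult_right_mono) auto
      then have "1 - real n * (t - a) \<le> 0" using N by linarith
      then show ?thesis using False by (simp add: f_def)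
    qed
    then have "eventually (\<lambda>n. f n t = 0) sequentially" by (auto simp: eventually_sequentially)
    then show ?thesis using False by (simp add: tendsto_eventually)
  qed
  have "(\<lambda>n. poly (q n) t) \<longlonglongrightarrow> indicator {..a} t" if t: "t \<in> {0..1}" for t
  proof -
    have "(\<lambda>n. poly (q n) t - f n t) \<longlonglongrightarrow> 0"
    proof (rule Lim_null_comparison)
      show "eventually (\<lambda>n. norm (poly (q n) t - f n t) \<le> 1 / real (Suc n)) sequentially"
        using q[OF t] by (intro always_eventually allI) (simp add: abs_minus_commute less_imp_le)
      show "(\<lambda>n. 1 / real (Suc n)) \<longlonglongrightarrow> 0" by (rule LIMSEQ_Suc[OF lim_1_over_n])
    qed
    from tendsto_add[OF this flim[of t]] show ?thesis by simp
  qed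
  from specproj_limit[of q 2, OF bd this] show ?thesis by simp
qed

lemma specproj_compl:
  assumes P: "specproj A B P" and B: "B \<in> sets borel"
  shows "specproj A (UNIV - B) (id_blinfun - P)"
proof -
  have "P (P x) = P x" for x using P unfolding specproj_def by (metis blinfun_apply_blinfun_compose)
  then have "(id_blinfun - P) o\<^sub>L (id_blinfun - P) = id_blinfun - P"
    by (intro blinfun_eqI) (simp add: blinfun.bilinear_simps)
  moreover have "(id_blinfun - P) o\<^sub>L S = S o\<^sub>L (id_blinfun - P)" if "A o\<^sub>L S = S o\<^sub>L A" for S
  proof -
    have "P (S x) = S (P x)" for x
      using P that unfolding specproj_def by (metis blinfun_apply_blinfun_compose)
    then show ?thesis by (intro blinfun_eqI) (simp add: blinfun.bilinear_simps)
  qed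
  moreover have "quad (id_blinfun - P) x = measure (vmeas A x) (UNIV - B)" for x
    using finite_measure.finite_measure_compl[OF vmeas_finite, of B x] B P
    by (simp add: quad_diff quad_id vmeas_UNIV specproj_def)
  moreover have "herm (id_blinfun - P)" using P unfolding specproj_def by (blast intro: herm_diff herm_id)
  ultimately show ?thesis unfolding specproj_def by blast
qed

lemma specproj_Union:
  fixes B :: "nat \<Rightarrow> real set"
  assumes disj: "disjoint_family B" and B: "range B \<subseteq> sets borel" and P: "\<And>i. specproj A (B i) (P i)"
  shows "\<exists>Q. specproj A (\<Union>i. B i) Q"
proof -
  have h: "herm (P i)" and id: "P i o\<^sub>L P i = P i" and qm: "quad (P i) x = measure (vmeas A x) (B i)" for i x
    using P by (auto simp: specproj_def)
  have qn: "quad (P i) x = (norm (P i x))\<^sup>2" for i x by (rule quad_idempotent[OF h id])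
  have PP: "P i (P i x) = P i x" for i x using id by (metis blinfun_apply_blinfun_compose)
  \<comment> \<open>At y = P j x the form of \<open>P j\<close> already takes all of |y|^2, and the
    masses of two disjoint sets add up to at most that; nothing is left for
    \<open>P i\<close>.\<close>
  have orth: "P i (P j x) = 0" if "i \<noteq> j" for i j x
  proof -
    let ?y = "P j x"
    interpret finite_measure "vmeas A ?y" by (rule vmeas_finite)
    have "quad (P i) ?y + quad (P j) ?y = measure (vmeas A ?y) (B i \<union> B j)"
      using that disj B unfolding qm
      by (subst finite_measure_Union) (auto simp: disjoint_family_on_def)
    also have "\<dots> \<le> (norm ?y)\<^sup>2"
      unfolding vmeas_UNIV[symmetric] by (rule finite_measure_mono) (use B in auto)
    finally have "(norm (P i ?y))\<^sup>2 \<le> 0" by (simp add: qn PP)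
    then show ?thesis by simp
  qed
  \<comment> \<open>Pythagoras; it converts the Cauchy property of the series of masses into that of
    the partial sums \<open>S n x\<close>.\<close>
  have nsum: "(norm (\<Sum>i\<in>I. P i x))\<^sup>2 = (\<Sum>i\<in>I. measure (vmeas A x) (B i))" if "finite I" for I x
    using that
  proof induction
    case (insert j I)
    have "cinner (P j x) (\<Sum>i\<in>I. P i x) = 0"
      unfolding cinner_sum_right
    proof (intro sum.neutral ballI)
      fix i assume "i \<in> I"
      then have "j \<noteq> i" using insert by auto
      then show "cinner (P j x) (P i x) = 0"
        using hermD[OF h, of x j "P i x"] by (simp add: orth)
    qed
    moreover from this have "cinner (\<Sum>i\<in>I. P i x) (P j x) = 0"
      by (metis cinner_commute complex_cnj_zero)
    ultimately have "(norm (P j x + (\<Sum>i\<in>I. P i x)))\<^sup>2 = (norm (P j x))\<^sup>2 + (norm (\<Sum>i\<in>I. P i x))\<^sup>2"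
      by (simp add: cinner_simps flip: Re_cinner_self)
    then show ?case using insert by (simp add: qm flip: qn)
  qed simp
  define S where "S n = (\<Sum>i<n. P i)" for n
  have Sx: "S n x = (\<Sum>i<n. P i x)" for n x by (simp add: S_def blinfun.sum_left)
  have sums: "(\<lambda>n. \<Sum>i<n. measure (vmeas A x) (B i)) \<longlonglongrightarrow> measure (vmeas A x) (\<Union>i. B i)" for x
    using finite_measure.finite_measure_UNION[OF vmeas_finite, of B x] B disj by (simp add: sums_def)
  have le: "(\<Sum>i<n. measure (vmeas A x) (B i)) \<le> (norm x)\<^sup>2" for n x
  proof -
    interpret finite_measure "vmeas A x" by (rule vmeas_finite)
    have "(\<Sum>i<n. measure (vmeas A x) (B i)) = measure (vmeas A x) (\<Union>i<n. B i)"
      by (rule finite_measure_finite_Union[symmetric])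
        (use B disj in \<open>auto simp: disjoint_family_on_def\<close>)
    also have "\<dots> \<le> (norm x)\<^sup>2"
      unfolding vmeas_UNIV[symmetric] by (rule finite_measure_mono) (use B in auto)
    finally show ?thesis .
  qed
  have "norm (S n) \<le> 1" for n
  proof (rule norm_blinfun_bound)
    fix x
    have "(norm (S n x))\<^sup>2 \<le> (norm x)\<^sup>2" using le[of x n] by (simp add: Sx nsum)
    then show "norm (S n x) \<le> 1 * norm x" by (simp add: power2_le_iff_abs_le)
  qed simp
  moreover have "Cauchy (\<lambda>n. S n x)" for x
  proof (rule metric_CauchyI)
    fix e :: real assume e: "e > 0"
    let ?s = "\<lambda>n. \<Sum>i<n. measure (vmeas A x) (B i)"
    have "Cauchy ?s" using sums by (rule LIMSEQ_imp_Cauchy)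
    then obtain N where N: "\<And>m n. m \<ge> N \<Longrightarrow> n \<ge> N \<Longrightarrow> dist (?s m) (?s n) < e\<^sup>2"
      using e metric_CauchyD[of ?s "e\<^sup>2"] by auto
    have main: "dist (S m x) (S n x) < e" if "N \<le> m" "m \<le> n" for m n
    proof -
      have split: "sum f {..<n} = sum f {..<m} + sum f {m..<n}" for f :: "nat \<Rightarrow> 'b::comm_monoid_add"
        using that by (metis ivl_disj_int_one(2) ivl_disj_un_one(2) finite_atLeastLessThan finite_lessThan sum.union_disjoint)
      have "(norm (S n x - S m x))\<^sup>2 = ?s n - ?s m"
        unfolding Sx split by (simp add: nsum)
      also have "\<dots> < e\<^sup>2" using N[of m n] that by (simp add: dist_real_def)
      finally show ?thesis using e by (simp add: dist_norm norm_minus_commute power_less_imp_less_base)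
    qed
    show "\<exists>M. \<forall>m\<ge>M. \<forall>n\<ge>M. dist (S m x) (S n x) < e"
      by (rule exI[of _ N]) (metis main dist_commute nle_le)
  qed
  ultimately obtain Q where Q: "\<And>x. (\<lambda>n. S n x) \<longlonglongrightarrow> blinfun_apply Q x"
    using strong_limit by blast
  have hQ: "herm Q" by (rule herm_lim[OF _ Q]) (simp add: S_def herm_sum h)
  have qQ: "quad Q x = measure (vmeas A x) (\<Union>i. B i)" for x
    using quad_tendsto[OF Q, of x] sums[of x] by (simp add: S_def quad_sum qm LIMSEQ_unique)
  have "(norm (Q x))\<^sup>2 = measure (vmeas A x) (\<Union>i. B i)" for x
  proof (rule LIMSEQ_unique[OF _ sums])
    have "(\<lambda>n. (norm (S n x))\<^sup>2) \<longlonglongrightarrow> (norm (Q x))\<^sup>2" by (intro tendsto_intros Q)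
    then show "(\<lambda>n. \<Sum>i<n. measure (vmeas A x) (B i)) \<longlonglongrightarrow> (norm (Q x))\<^sup>2" by (simp add: Sx nsum)
  qed
  then have "Q o\<^sub>L Q = Q" by (intro idempotentI hQ) (simp add: qQ)
  moreover have "Q o\<^sub>L T = T o\<^sub>L Q" if "A o\<^sub>L T = T o\<^sub>L A" for T
  proof (rule strong_limit_commute[OF Q])
    fix n
    have "P i (T x) = T (P i x)" for i x
      using P that unfolding specproj_def by (metis blinfun_apply_blinfun_compose)
    then show "S n o\<^sub>L T = T o\<^sub>L S n"
      by (intro blinfun_eqI) (simp add: Sx blinfun.sum_right)
  qed
  ultimately show ?thesis using hQ qQ unfolding specproj_def by blast
qed

text \<open>Half-lines are stable under intersection and generate the Borel sets, so closure under
  complements and disjoint unions suffices.\<close>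

lemma specproj_exists:
  assumes "B \<in> sets borel"
  shows "\<exists>P. specproj A B P"
proof -
  have eq: "sets borel = sigma_sets UNIV (range (\<lambda>a::real. {..a}))"
    by (subst borel_eq_atMost) simp
  have st: "Int_stable (range (\<lambda>a::real. {..a}))"
    by (auto simp: Int_stable_def)
  have "range (\<lambda>a::real. {..a}) \<subseteq> Pow UNIV" by simp
  from st this assms[unfolded eq] show ?thesis
  proof (induction rule: sigma_sets_induct_disjoint)
    case (basic B)
    then show ?case using specproj_atMost by auto
  next
    case empty
    show ?case by (rule exI[of _ 0]) (auto simp: specproj_def quad_zero)
  next
    case (compl B)
    then show ?case using specproj_compl by (auto simp: eq)
  next
    case (union B)
    then obtain P where "\<And>i. specproj A (B i) (P i)" by metis
    with union show ?case by (intro specproj_Union[of B P]) (auto simp: eq)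
  qed
qed

theorem spectral_theorem:
  obtains E where "pvm E" "\<And>x. AE t in scalar_measure E x. t \<in> {0..1}"
    "\<And>x p. (\<integral>t. poly p t \<partial>scalar_measure E x) = quad (pop A p) x"
    "\<And>\<Delta> S. \<Delta> \<in> sets borel \<Longrightarrow> A o\<^sub>L S = S o\<^sub>L A \<Longrightarrow> E \<Delta> o\<^sub>L S = S o\<^sub>L E \<Delta>"
proof -
  define E where "E \<Delta> = (SOME P. specproj A \<Delta> P)" for \<Delta>
  have E: "specproj A \<Delta> (E \<Delta>)" if "\<Delta> \<in> sets borel" for \<Delta>
    unfolding E_def by (rule someI_ex[OF specproj_exists[OF that]])
  have h: "herm (E \<Delta>)" and q: "quad (E \<Delta>) x = measure (vmeas A x) \<Delta>" if "\<Delta> \<in> sets borel" for \<Delta> x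
    using E[OF that] unfolding specproj_def by blast+
  have idem: "E \<Delta> o\<^sub>L E \<Delta> = E \<Delta>" if "\<Delta> \<in> sets borel" for \<Delta>
    using E[OF that] unfolding specproj_def by blast
  have comm: "E \<Delta> o\<^sub>L S = S o\<^sub>L E \<Delta>" if "\<Delta> \<in> sets borel" "A o\<^sub>L S = S o\<^sub>L A" for \<Delta> S
    using E[OF that(1)] that(2) unfolding specproj_def by blast
  have p: "povm E"
    unfolding povm_def positive_operators_iff
  proof (intro conjI ballI allI impI)
    fix \<Delta> :: "nat \<Rightarrow> real set" and x y :: 'a
    assume D: "range \<Delta> \<subseteq> sets borel \<and> disjoint_family \<Delta>"
    have s: "(\<lambda>n. complex_of_real (quad (E (\<Delta> n)) z)) sums of_real (quad (E (\<Union>n. \<Delta> n)) z)" for z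
      using finite_measure.finite_measure_UNION[OF vmeas_finite, of \<Delta> z] D
      by (subst sums_of_real_iff) (auto simp: q subset_eq)
    \<comment> \<open>Countable additivity is known for quadratic forms; polarization carries it to
      all matrix elements.\<close>
    have "(\<lambda>n. 4 * cinner x (E (\<Delta> n) y)) sums (4 * cinner x (E (\<Union>n. \<Delta> n) y))"
      using D by (subst (1 2) polarization; (intro h; auto)?)
        (auto simp only: of_real_diff intro!: sums_add sums_diff sums_mult s)
    then show "(\<lambda>n. cinner x (E (\<Delta> n) y)) sums cinner x (E (\<Union>n. \<Delta> n) y)"
      by (subst (asm) sums_mult_iff) auto
  qed (simp_all add: h q)
  moreover have "E UNIV = id_blinfun"
    by (rule herm_eqI) (simp_all add: h q quad_id vmeas_UNIV)
  ultimately have pvm: "pvm E"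
    using idem by (simp add: pvm_def normalized_povm_def)
  have sm: "scalar_measure E x = vmeas A x" for x
  proof (rule measure_eqI)
    interpret finite_measure "vmeas A x" by (rule vmeas_finite)
    show "emeasure (scalar_measure E x) \<Delta> = emeasure (vmeas A x) \<Delta>"
      if "\<Delta> \<in> sets (scalar_measure E x)" for \<Delta>
      using that by (simp add: emeasure_scalar_measure[OF p] q emeasure_eq_measure)
  qed simp
  show ?thesis
    by (rule that[OF pvm, unfolded sm, OF vmeas_AE vmeas_poly comm])
qed

end

subsection \<open>Norm closure of the polynomials in an operator\<close>

text \<open>Norm closure, in contrast to strong closure: its members will correspond to continuous
  rather than merely Borel functions on the support of the spectral measure.\<close>

definition palg :: "('a::chilbert_space \<Rightarrow>\<^sub>L 'a) \<Rightarrow> ('a \<Rightarrow>\<^sub>L 'a) set" where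
  "palg A = closure (range (pop A))"

lemma palg_sequential: "T \<in> palg A \<longleftrightarrow> (\<exists>p. (\<lambda>n. pop A (p n)) \<longlonglongrightarrow> T)"
  unfolding palg_def closure_sequential
proof
  assume "\<exists>X. (\<forall>n. X n \<in> range (pop A)) \<and> X \<longlonglongrightarrow> T"
  then obtain X where X: "\<forall>n. \<exists>p. X n = pop A p" "X \<longlonglongrightarrow> T" by blast
  then obtain p where "\<And>n. X n = pop A (p n)" by metis
  then have "X = (\<lambda>n. pop A (p n))" by blast
  with X(2) show "\<exists>p. (\<lambda>n. pop A (p n)) \<longlonglongrightarrow> T" by blast
next
  assume "\<exists>p. (\<lambda>n. pop A (p n)) \<longlonglongrightarrow> T"
  then obtain p where "(\<lambda>n. pop A (p n)) \<longlonglongrightarrow> T" ..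
  then show "\<exists>X. (\<forall>n. X n \<in> range (pop A)) \<and> X \<longlonglongrightarrow> T"
    by (intro exI[of _ "\<lambda>n. pop A (p n)"]) simp
qed

lemma palg_pop: "pop A p \<in> palg A"
  unfolding palg_def by (rule subsetD[OF closure_subset]) simp

lemma palg_self: "A \<in> palg A"
  using palg_pop[of A "[:0,1:]"] by (simp only: pop_X)

lemma palg_lim: "(\<And>n. T n \<in> palg A) \<Longrightarrow> T \<longlonglongrightarrow> S \<Longrightarrow> S \<in> palg A"
  unfolding palg_def by (rule closed_sequentially[OF closed_closure])

lemma palg_add:
  assumes "S \<in> palg A" "T \<in> palg A"
  shows "S + T \<in> palg A"
proof -
  obtain p q where "(\<lambda>n. pop A (p n)) \<longlonglongrightarrow> S" "(\<lambda>n. pop A (q n)) \<longlonglongrightarrow> T"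
    using assms by (auto simp: palg_sequential)
  then have "(\<lambda>n. pop A (p n + q n)) \<longlonglongrightarrow> S + T"
    unfolding pop_add by (rule tendsto_add)
  then show ?thesis unfolding palg_sequential by (rule exI[of _ "\<lambda>n. p n + q n"])
qed

lemma palg_scaleR:
  assumes "T \<in> palg A"
  shows "r *\<^sub>R T \<in> palg A"
proof -
  obtain p where "(\<lambda>n. pop A (p n)) \<longlonglongrightarrow> T" using assms by (auto simp: palg_sequential)
  then have "(\<lambda>n. pop A (smult r (p n))) \<longlonglongrightarrow> r *\<^sub>R T"
    unfolding pop_smult by (intro tendsto_scaleR tendsto_const)
  then show ?thesis unfolding palg_sequential by (rule exI[of _ "\<lambda>n. smult r (p n)"])
qed

lemma palg_diff: "S \<in> palg A \<Longrightarrow> T \<in> palg A \<Longrightarrow> S - T \<in> palg A"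
  using palg_add[of S A "(-1) *\<^sub>R T"] palg_scaleR[of T A "-1"] by simp

lemma palg_sum: "(\<And>i. i \<in> I \<Longrightarrow> f i \<in> palg A) \<Longrightarrow> (\<Sum>i\<in>I. f i) \<in> palg A"
  using palg_pop[of A 0]
  by (induction I rule: infinite_finite_induct) (auto intro: palg_add)

lemma palg_compose:
  assumes "S \<in> palg A" "T \<in> palg A"
  shows "S o\<^sub>L T \<in> palg A"
proof -
  obtain p q where "(\<lambda>n. pop A (p n)) \<longlonglongrightarrow> S" "(\<lambda>n. pop A (q n)) \<longlonglongrightarrow> T"
    using assms by (auto simp: palg_sequential)
  then have "(\<lambda>n. pop A (p n * q n)) \<longlonglongrightarrow> (S o\<^sub>L T)"
    unfolding pop_mult by (rule bounded_bilinear.tendsto[OF bounded_bilinear_blinfun_compose])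
  then show ?thesis unfolding palg_sequential by (rule exI[of _ "\<lambda>n. p n * q n"])
qed

section \<open>Norm recovery of commuting projections from a weighted sum\<close>

lemma norm_projection_le:
  assumes "herm P" "P o\<^sub>L P = P"
  shows "norm P \<le> 1"
proof (rule norm_blinfun_bound)
  fix x
  have "(norm (P x))\<^sup>2 = Re (cinner x (P x))"
    using quad_idempotent[OF assms, of x] by (simp add: quad_def)
  also have "\<dots> \<le> norm x * norm (P x)" by (rule Re_cinner_le)
  finally show "norm (P x) \<le> 1 * norm x"
    by (cases "P x = 0") (auto simp: power2_eq_square)
qed simp

text \<open>The map \<open>t \<mapsto> 3 t\<^sup>2 - 2 t\<^sup>3\<close> fixes \<open>0\<close> and \<open>1\<close> with vanishing derivative, so its iterates at
  an operator close to a commuting projection \<open>P\<close> converge to \<open>P\<close>.\<close>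

lemma palg_projection:
  assumes P: "norm P \<le> 1" "P o\<^sub>L P = P" and D: "P o\<^sub>L D = D o\<^sub>L P" "norm D \<le> 1/32"
    and PD: "P + D \<in> palg A"
  shows "P \<in> palg A"
proof -
  define G where "G r D \<longleftrightarrow> P o\<^sub>L D = D o\<^sub>L P \<and> norm D \<le> r \<and> P + D \<in> palg A" for r D
  have step: "\<exists>D'. G (r/2) D'" if G: "G r D" and r: "r \<le> 1/32" for r D
  proof -
    have cD: "D (P x) = P (D x)" and PP: "P (P x) = P x" for x
      using G P unfolding G_def by (metis blinfun_apply_blinfun_compose)+
    have nD: "norm D \<le> r" using G by (simp add: G_def)
    have r0: "0 \<le> r" using nD norm_ge_zero order_trans by blast
    define X where "X = P + D"
    \<comment> \<open>At X = P + D, with P idempotent and commuting with D, the polynomial 3 X^2 - 2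
      X^3 equals P + 3 Q - 2 D^3: the terms linear in D cancel.\<close>
    define Q where "Q = (D o\<^sub>L D) - ((P o\<^sub>L (D o\<^sub>L D)) + (P o\<^sub>L (D o\<^sub>L D)))"
    define D' where "D' = Q + Q + Q - (D o\<^sub>L (D o\<^sub>L D)) - (D o\<^sub>L (D o\<^sub>L D))"
    have X: "X \<in> palg A" using G by (simp add: G_def X_def)
    have "P + D' = (X o\<^sub>L X) + (X o\<^sub>L X) + (X o\<^sub>L X) - (X o\<^sub>L (X o\<^sub>L X)) - (X o\<^sub>L (X o\<^sub>L X))"
      unfolding X_def D'_def Q_def
      by (rule blinfun_eqI) (simp add: blinfun.bilinear_simps cD PP)
    then have "P + D' \<in> palg A"
      using X by (auto intro!: palg_diff palg_add palg_compose)
    moreover have "P o\<^sub>L D' = D' o\<^sub>L P"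
      unfolding D'_def Q_def by (rule blinfun_eqI) (simp add: blinfun.bilinear_simps cD PP)
    moreover have "norm D' \<le> r / 2"
    proof -
      have DD: "norm (D o\<^sub>L D) \<le> r * r"
        by (rule order_trans[OF norm_blinfun_compose]) (intro mult_mono nD r0 norm_ge_zero)
      have PDD: "norm (P o\<^sub>L (D o\<^sub>L D)) \<le> 1 * (r * r)"
        by (rule order_trans[OF norm_blinfun_compose]) (intro mult_mono P DD norm_ge_zero zero_le_one)
      have DDD: "norm (D o\<^sub>L (D o\<^sub>L D)) \<le> r * (r * r)"
        by (rule order_trans[OF norm_blinfun_compose]) (intro mult_mono nD DD r0 norm_ge_zero)
      have "norm Q \<le> r * r + (1 * (r * r) + 1 * (r * r))"
        unfolding Q_def by (intro norm_triangle_le_diff norm_triangle_le add_mono DD PDD)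
      then have Q: "norm Q \<le> 3 * (r * r)" by simp
      have "norm D' \<le> 3 * (r * r) + 3 * (r * r) + 3 * (r * r) + r * (r * r) + r * (r * r)"
        unfolding D'_def by (intro norm_triangle_le_diff norm_triangle_le add_mono Q DDD)
      also have "\<dots> = r * (9 * r + 2 * (r * r))" by (simp add: algebra_simps)
      \<comment> \<open>For r up to 1/32 the value 9 r + 2 r^2 is below 1/2, so each iteration at
        least halves the error bound.\<close>
      also have "\<dots> \<le> r * (1/2)"
      proof (rule mult_left_mono[OF _ r0])
        have "r * r \<le> (1/32) * (1/32)" using r r0 by (intro mult_mono) auto
        then show "9 * r + 2 * (r * r) \<le> 1/2" using r by simp
      qed
      finally show ?thesis by simp
    qed
    ultimately show ?thesis unfolding G_def by blast
  qed
  have "\<exists>D. G ((1/32) * (1/2)^n) D" for n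
  proof (induction n)
    case 0
    show ?case using D PD by (auto simp: G_def)
  next
    case (Suc n)
    then obtain D where "G ((1/32) * (1/2)^n) D" by blast
    moreover have "(1/32) * (1/2)^n \<le> (1/32 :: real)" by (simp add: power_le_one)
    ultimately show ?case using step by (fastforce simp: field_simps)
  qed
  then obtain E where E: "\<And>n. G ((1/32) * (1/2)^n) (E n)" by metis
  have "(\<lambda>n. (1/32) * (1/2 :: real)^n) \<longlonglongrightarrow> 0"
    by (intro tendsto_mult_right_zero LIMSEQ_realpow_zero) auto
  then have "E \<longlonglongrightarrow> 0"
    by (rule Lim_null_comparison[rotated]) (use E in \<open>auto simp: G_def\<close>)
  from tendsto_add[OF tendsto_const this] have "(\<lambda>n. P + E n) \<longlonglongrightarrow> P" by simp
  then show ?thesis by (rule palg_lim[rotated]) (use E in \<open>auto simp: G_def\<close>)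
qed

lemma unit_op_norm_le: "unit_op T \<Longrightarrow> norm T \<le> 1"
  by (rule herm_norm_le) (auto simp: unit_op_def)

text \<open>The numerator 63 normalizes the weights to total 1, which keeps the weighted sum of
  projections between 0 and the identity.\<close>

lemma geometric_64: "(\<Sum>n<N. 63 / 64 ^ Suc n) = 1 - 1 / (64::real) ^ N"
  by (induction N) (simp_all add: field_simps)

text \<open>The base \<open>64\<close> is large enough for the operator \<open>\<Sum>\<^sub>n 63 \<cdot> 64\<^sup>-\<^sup>n\<^sup>-\<^sup>1 P\<^sub>n\<close> to be within \<open>1/32\<close> of
  \<open>P\<^sub>0\<close>, which makes it possible to recover the \<open>P\<^sub>n\<close> one after the other.\<close>

lemma projections_generator:
  fixes P :: "nat \<Rightarrow> 'a::chilbert_space \<Rightarrow>\<^sub>L 'a"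
  assumes h: "\<And>n. herm (P n)" and id: "\<And>n. P n o\<^sub>L P n = P n"
    and comm: "\<And>m n. P m o\<^sub>L P n = P n o\<^sub>L P m"
  obtains A where "unit_op A" "\<And>n. P n \<in> palg A"
proof -
  let ?c = "\<lambda>n. 63 / 64 ^ Suc n :: real"
  have nP: "norm (P n) \<le> 1" for n by (rule norm_projection_le[OF h id])
  have qP: "0 \<le> quad (P n) x" "quad (P n) x \<le> (norm x)\<^sup>2" for n x
  proof -
    show "0 \<le> quad (P n) x" by (simp add: quad_idempotent[OF h id])
    have "norm (P n x) \<le> norm x"
      using norm_blinfun[of "P n" x] nP[of n] mult_right_mono[OF nP[of n] norm_ge_zero[of x]] by simp
    then show "quad (P n) x \<le> (norm x)\<^sup>2" by (simp add: quad_idempotent[OF h id] power_mono)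
  qed
  have sc: "summable ?c"
  proof -
    have "?c sums 1"
      unfolding sums_def geometric_64
      using tendsto_diff[OF tendsto_const LIMSEQ_inverse_realpow_zero[of 64], of 1]
      by (simp add: divide_inverse power_inverse)
    then show ?thesis by (rule sums_summable)
  qed
  have sm: "summable (\<lambda>n. ?c n *\<^sub>R P (n + m))" for m
    by (rule summable_comparison_test[OF _ sc])
      (use nP in \<open>auto intro!: exI[of _ 0] divide_right_mono simp: mult_left_le\<close>)
  define S where "S m N = (\<Sum>n<N. ?c n *\<^sub>R P (n + m))" for m N
  \<comment> \<open>The same weighted sum with the first \<open>m\<close> projections dropped;
    \<open>B 0\<close> is the generator.\<close>
  define B where "B m = (\<Sum>n. ?c n *\<^sub>R P (n + m))" for m
  have lim: "(\<lambda>N. S m N) \<longlonglongrightarrow> B m" for m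
    unfolding S_def B_def by (rule summable_LIMSEQ[OF sm])
  have limx: "(\<lambda>N. S m N x) \<longlonglongrightarrow> B m x" for m x
    by (intro blinfun.tendsto lim tendsto_const)
  have hB: "herm (B m)" for m
    by (rule herm_lim[OF _ limx]) (simp add: S_def herm_sum herm_scaleR h)
  have unit: "unit_op (B m)" for m
    unfolding unit_op_def
  proof (intro conjI hB allI)
    fix x
    have q: "(\<lambda>N. quad (S m N) x) \<longlonglongrightarrow> quad (B m) x" by (rule quad_tendsto[OF limx])
    have S: "quad (S m N) x = (\<Sum>n<N. ?c n * quad (P (n + m)) x)" for N
      by (simp add: S_def quad_sum quad_scaleR)
    have "0 \<le> quad (S m N) x" for N unfolding S by (intro sum_nonneg mult_nonneg_nonneg qP) auto
    then show "0 \<le> quad (B m) x" by (intro LIMSEQ_le_const[OF q]) auto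
    have "quad (S m N) x \<le> (norm x)\<^sup>2" for N
    proof -
      have "quad (S m N) x \<le> (\<Sum>n<N. ?c n * (norm x)\<^sup>2)"
        unfolding S by (intro sum_mono mult_left_mono qP) auto
      also have "\<dots> = (1 - 1 / 64 ^ N) * (norm x)\<^sup>2"
        unfolding sum_distrib_right[symmetric] geometric_64 ..
      also have "\<dots> \<le> 1 * (norm x)\<^sup>2" by (intro mult_right_mono) auto
      finally show ?thesis by simp
    qed
    then show "quad (B m) x \<le> (norm x)\<^sup>2" by (intro LIMSEQ_le_const2[OF q]) auto
  qed
  have PB: "P k o\<^sub>L B m = B m o\<^sub>L P k" for k m
  proof (rule strong_limit_commute[OF limx, symmetric])
    fix N
    have "P i (P k x) = P k (P i x)" for i x using comm by (metis blinfun_apply_blinfun_compose)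
    then show "S m N o\<^sub>L P k = P k o\<^sub>L S m N"
      by (intro blinfun_eqI)
        (simp add: S_def blinfun.sum_left blinfun.sum_right blinfun.scaleR_left blinfun.scaleR_right)
  qed
  have B_Suc: "B m = (63/64) *\<^sub>R P m + (1/64) *\<^sub>R B (Suc m)" for m
  proof -
    have "B m = (\<Sum>n. ?c (Suc n) *\<^sub>R P (Suc n + m)) + ?c 0 *\<^sub>R P (0 + m)"
      unfolding B_def using suminf_split_head[OF sm[of m]] by (simp only: eq_diff_eq)
    also have "(\<Sum>n. ?c (Suc n) *\<^sub>R P (Suc n + m)) = (\<Sum>n. (1/64) *\<^sub>R (?c n *\<^sub>R P (n + Suc m)))"
      by simp
    also have "\<dots> = (1/64) *\<^sub>R B (Suc m)"
      unfolding B_def by (rule suminf_scaleR_right[OF sm, symmetric])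
    finally show ?thesis by simp
  qed
  have P_in: "P m \<in> palg A" if "B m \<in> palg A" for m A
  proof (rule palg_projection[OF nP id])
    \<comment> \<open>\<open>B (Suc m)\<close> and \<open>P m\<close> have norm at most 1, so this
      error is at most 2/64.\<close>
    define D where "D = (1/64) *\<^sub>R (B (Suc m) - P m)"
    have "(63/64) *\<^sub>R P m = P m - (1/64) *\<^sub>R P m"
      by (simp add: eq_diff_eq flip: scaleR_add_left)
    then have BD: "P m + D = B m"
      unfolding B_Suc[of m] D_def by (simp add: scaleR_diff_right)
    show "P m o\<^sub>L D = D o\<^sub>L P m"
      using PB by (simp add: D_def bounded_bilinear.scaleR_left[OF bounded_bilinear_blinfun_compose]
          bounded_bilinear.scaleR_right[OF bounded_bilinear_blinfun_compose]
          bounded_bilinear.diff_left[OF bounded_bilinear_blinfun_compose]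
          bounded_bilinear.diff_right[OF bounded_bilinear_blinfun_compose])
    have "norm (B (Suc m) - P m) \<le> 1 + 1"
      by (intro norm_triangle_le_diff add_mono nP unit_op_norm_le[OF unit])
    then show "norm D \<le> 1/32" by (simp add: D_def)
    show "P m + D \<in> palg A" using that BD by simp
  qed
  have B_in: "B m \<in> palg (B 0)" for m
  proof (induction m)
    case (Suc m)
    \<comment> \<open>Once \<open>P m\<close> is recovered it is subtracted and the rest rescaled,
      as in shifting out the leading digit in base 64.\<close>
    have "B (Suc m) = 64 *\<^sub>R B m - 63 *\<^sub>R P m"
      unfolding B_Suc[of m] by (simp add: scaleR_add_right)
    then show ?case using Suc P_in[OF Suc] by (auto intro!: palg_diff palg_scaleR)
  qed (rule palg_self)
  show ?thesis by (rule that[OF unit P_in[OF B_in]])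
qed

subsection \<open>Binary digits of an operator\<close>

text \<open>One step of a binary expansion: \<open>P\<close> is the leading digit and 2 T - P the
  remainder, which has to lie between 0 and the identity again so that the step can be iterated. The
  last clause keeps all digits in the double commutant.\<close>

definition is_digit :: "('a::chilbert_space \<Rightarrow>\<^sub>L 'a) \<Rightarrow> ('a \<Rightarrow>\<^sub>L 'a) \<Rightarrow> bool" where
  "is_digit T P \<longleftrightarrow> herm P \<and> P o\<^sub>L P = P \<and> unit_op (2 *\<^sub>R T - P) \<and>
     (\<forall>S. T o\<^sub>L S = S o\<^sub>L T \<longrightarrow> P o\<^sub>L S = S o\<^sub>L P)"

lemma integrable_unit_interval:
  fixes f :: "real \<Rightarrow> real"
  assumes "finite_measure M" "sets M = sets borel" "AE t in M. t \<in> {0..1}" "continuous_on UNIV f"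
  shows "integrable M f"
proof -
  interpret finite_measure M by fact
  have "f \<in> borel_measurable borel" by (rule borel_measurable_continuous_onI) fact
  then have "f \<in> borel_measurable M" using assms(2) by (simp cong: measurable_cong_sets)
  moreover have "bounded (f ` {0..1})"
    by (intro compact_imp_bounded compact_continuous_image continuous_on_subset[OF assms(4)]) auto
  then obtain C where "\<And>t. t \<in> {0..1} \<Longrightarrow> norm (f t) \<le> C" unfolding bounded_iff by blast
  ultimately show ?thesis
    by (intro integrable_const_bound[of _ C]) (use assms(3) in \<open>auto elim!: AE_mp\<close>)
qed

lemma is_digit_exists:
  assumes T: "unit_op T"
  shows "\<exists>P. is_digit T P"
proof -
  obtain E where E: "pvm E" "\<And>x. AE t in scalar_measure E x. t \<in> {0..1}"
    "\<And>x p. (\<integral>t. poly p t \<partial>scalar_measure E x) = quad (pop T p) x"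
    "\<And>\<Delta> S. \<Delta> \<in> sets borel \<Longrightarrow> T o\<^sub>L S = S o\<^sub>L T \<Longrightarrow> E \<Delta> o\<^sub>L S = S o\<^sub>L E \<Delta>"
    using spectral_theorem[OF T] by blast
  \<comment> \<open>Digit 1 from 1/2 on: both 2 t on [0, 1/2) and 2 t - 1 on [1/2, 1] stay in the
    unit interval; t = 1 has digit 1 and remainder 1.\<close>
  let ?H = "{1/2..} :: real set"
  have p: "povm E" using E(1) by (simp add: pvm_def normalized_povm_def)
  have h: "herm (E ?H)" by (rule povm_herm[OF p]) simp
  have "unit_op (2 *\<^sub>R T - E ?H)"
    unfolding unit_op_def
  proof (intro conjI allI)
    show "herm (2 *\<^sub>R T - E ?H)"
      using T h by (intro herm_diff herm_scaleR) (auto simp: unit_op_def)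
    fix x
    interpret finite_measure "scalar_measure E x" by (rule finite_scalar_measure[OF p])
    have i: "integrable (scalar_measure E x) (poly q)" for q :: "real poly"
      by (rule integrable_unit_interval[OF finite_measure_axioms _ E(2)])
        (auto intro!: continuous_intros)
    have iH: "integrable (scalar_measure E x) (indicator ?H :: real \<Rightarrow> real)"
      by (rule integrable_const_bound[of _ 1]) auto
    let ?f = "\<lambda>t. poly [:0,2:] t - indicator ?H t :: real"
    have e: "quad (2 *\<^sub>R T - E ?H) x = (\<integral>t. ?f t \<partial>scalar_measure E x)"
    proof -
      have "(\<integral>t. ?f t \<partial>scalar_measure E x) = quad (pop T [:0,2:]) x - quad (E ?H) x"
        using i[of "[:0,2:]"] iH by (simp add: E(3)[symmetric] measure_scalar_measure[OF p] del: poly_pCons)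
      moreover have "pop T [:0,2:] = 2 *\<^sub>R T"
        using pop_smult[of T 2 "[:0,1:]"] pop_X[of T] by simp
      ultimately show ?thesis by (simp only: quad_diff)
    qed
    have n: "(norm x)\<^sup>2 = (\<integral>t. 1 \<partial>scalar_measure E x)"
      using E(3)[of x 1] by (simp add: quad_id)
    have if': "integrable (scalar_measure E x) ?f" using i[of "[:0,2:]"] iH by (rule Bochner_Integration.integrable_diff)
    show "0 \<le> quad (2 *\<^sub>R T - E ?H) x"
      unfolding e by (rule integral_nonneg_AE) (use E(2)[of x] in \<open>auto elim!: AE_mp simp: indicator_def\<close>)
    show "quad (2 *\<^sub>R T - E ?H) x \<le> (norm x)\<^sup>2"
      unfolding e n by (rule integral_mono_AE[OF if'])
        (use E(2)[of x] in \<open>auto elim!: AE_mp simp: indicator_def\<close>)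
  qed
  moreover have "E ?H o\<^sub>L E ?H = E ?H" using E(1) by (simp add: pvm_def)
  moreover have "\<forall>S. T o\<^sub>L S = S o\<^sub>L T \<longrightarrow> E ?H o\<^sub>L S = S o\<^sub>L E ?H"
    by (intro allI impI, rule E(4), simp, assumption)
  ultimately have "is_digit T (E ?H)"
    using h unfolding is_digit_def by blast
  then show ?thesis by blast
qed

definition digit :: "('a::chilbert_space \<Rightarrow>\<^sub>L 'a) \<Rightarrow> ('a \<Rightarrow>\<^sub>L 'a)" where
  "digit T = (SOME P. is_digit T P)"

definition digit_rest :: "('a::chilbert_space \<Rightarrow>\<^sub>L 'a) \<Rightarrow> ('a \<Rightarrow>\<^sub>L 'a)" where
  "digit_rest T = 2 *\<^sub>R T - digit T"

lemma digit: "unit_op T \<Longrightarrow> is_digit T (digit T)"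
  unfolding digit_def by (rule someI_ex[OF is_digit_exists])

lemma unit_op_digit_rest: "unit_op T \<Longrightarrow> unit_op (digit_rest T)"
  using digit[of T] by (simp add: is_digit_def digit_rest_def)

lemma unit_op_funpow_digit_rest: "unit_op T \<Longrightarrow> unit_op ((digit_rest ^^ n) T)"
  by (induction n) (auto intro: unit_op_digit_rest)

lemma digit_commute: "unit_op T \<Longrightarrow> T o\<^sub>L S = S o\<^sub>L T \<Longrightarrow> digit T o\<^sub>L S = S o\<^sub>L digit T"
  using digit[of T] unfolding is_digit_def by blast

lemma digit_rest_commute:
  assumes "unit_op T" "T o\<^sub>L S = S o\<^sub>L T"
  shows "digit_rest T o\<^sub>L S = S o\<^sub>L digit_rest T"
proof -
  have "T (S x) = S (T x)" "digit T (S x) = S (digit T x)" for x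
    using assms digit_commute[OF assms] by (metis blinfun_apply_blinfun_compose)+
  then show ?thesis
    by (intro blinfun_eqI) (simp add: digit_rest_def blinfun.bilinear_simps)
qed

lemma funpow_digit_rest_commute:
  "unit_op T \<Longrightarrow> T o\<^sub>L S = S o\<^sub>L T \<Longrightarrow> (digit_rest ^^ n) T o\<^sub>L S = S o\<^sub>L (digit_rest ^^ n) T"
  by (induction n) (auto intro!: digit_rest_commute unit_op_funpow_digit_rest)

text \<open>Iteration of T = (digit + remainder) / 2.\<close>

lemma digit_expansion:
  "T = (\<Sum>j<n. (1/2)^Suc j *\<^sub>R digit ((digit_rest ^^ j) T)) + (1/2)^n *\<^sub>R (digit_rest ^^ n) T"
proof (induction n)
  case (Suc n)
  let ?R = "(digit_rest ^^ n) T"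
  have "(1/2)^n *\<^sub>R ?R = (1/2)^Suc n *\<^sub>R digit ?R + (1/2)^Suc n *\<^sub>R digit_rest ?R"
    by (simp add: digit_rest_def scaleR_diff_right)
  then show ?case using Suc by (simp add: add.assoc)
qed simp

text \<open>All remainders have norm at most 1, so the expansion converges in norm at the rate
  2^-n.\<close>

lemma palg_digits:
  assumes T: "unit_op T" and d: "\<And>j. digit ((digit_rest ^^ j) T) \<in> palg A"
  shows "T \<in> palg A"
proof -
  define S where "S n = (\<Sum>j<n. (1/2)^Suc j *\<^sub>R digit ((digit_rest ^^ j) T))" for n
  have "(\<lambda>n. (1/2)^n *\<^sub>R (digit_rest ^^ n) T) \<longlonglongrightarrow> 0"
  proof (rule Lim_null_comparison)
    show "(\<lambda>n. (1/2 :: real)^n) \<longlonglongrightarrow> 0" by (rule LIMSEQ_realpow_zero) auto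
    show "eventually (\<lambda>n. norm ((1/2)^n *\<^sub>R (digit_rest ^^ n) T) \<le> (1/2)^n) sequentially"
      using unit_op_norm_le[OF unit_op_funpow_digit_rest[OF T]]
      by (intro always_eventually allI) (simp add: mult_left_le power_divide divide_right_mono)
  qed
  from tendsto_diff[OF tendsto_const[of T] this]
  have "(\<lambda>n. T - (1/2)^n *\<^sub>R (digit_rest ^^ n) T) \<longlonglongrightarrow> T" by simp
  moreover have "T - (1/2)^n *\<^sub>R (digit_rest ^^ n) T = S n" for n
    using digit_expansion[of T n] by (simp only: S_def diff_eq_eq)
  ultimately have "S \<longlonglongrightarrow> T" by simp
  then show ?thesis
    by (rule palg_lim[rotated]) (unfold S_def, intro palg_sum palg_scaleR d)
qed

lemma commuting_generator:
  fixes T :: "nat \<Rightarrow> 'a::chilbert_space \<Rightarrow>\<^sub>L 'a"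
  assumes T: "\<And>k. unit_op (T k)" and comm: "\<And>k l. T k o\<^sub>L T l = T l o\<^sub>L T k"
  obtains A where "unit_op A" "\<And>k. T k \<in> palg A"
proof -
  define Q where "Q k j = digit ((digit_rest ^^ j) (T k))" for k j
  define P where "P n = Q (fst (prod_decode n)) (snd (prod_decode n))" for n
  have Q: "is_digit ((digit_rest ^^ j) (T k)) (Q k j)" for k j
    unfolding Q_def by (intro digit unit_op_funpow_digit_rest T)
  have 1: "Q k j o\<^sub>L S = S o\<^sub>L Q k j" if "T k o\<^sub>L S = S o\<^sub>L T k" for k j S
    unfolding Q_def by (intro digit_commute funpow_digit_rest_commute unit_op_funpow_digit_rest T that)
  \<comment> \<open>Commutation is transferred twice: from \<open>T l\<close> to its digit, which
    therefore commutes with \<open>T k\<close>, and then from \<open>T k\<close> to its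
    digit.\<close>
  have 2: "Q k j o\<^sub>L Q l i = Q l i o\<^sub>L Q k j" for k j l i
    by (rule 1) (rule 1[OF comm, symmetric])
  have "herm (P n)" "P n o\<^sub>L P n = P n" "P m o\<^sub>L P n = P n o\<^sub>L P m" for m n
    using Q 2 unfolding P_def is_digit_def by blast+
  then obtain A where A: "unit_op A" "\<And>n. P n \<in> palg A" using projections_generator by blast
  have Q_in: "Q k j \<in> palg A" for k j using A(2)[of "prod_encode (k, j)"] by (simp add: P_def)
  have "T k \<in> palg A" for k by (rule palg_digits[OF T]) (rule Q_in[unfolded Q_def])
  with A(1) show ?thesis by (rule that)
qed

subsection \<open>Absolutely continuous operator measures\<close>

lemma povm_Un:
  assumes "povm F" "A \<in> sets borel" "B \<in> sets borel" "A \<inter> B = {}"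
  shows "F (A \<union> B) = F A + F B"
proof (rule herm_eqI)
  show "quad (F (A \<union> B)) x = quad (F A + F B) x" for x
    using finite_measure.finite_measure_Union[OF finite_scalar_measure[OF assms(1)], of A x B] assms
    by (simp add: measure_scalar_measure quad_add)
qed (use povm_herm[OF assms(1)] assms in \<open>auto intro: herm_add\<close>)

lemma povm_unit_op:
  assumes "normalized_povm F" "\<Delta> \<in> sets borel"
  shows "unit_op (F \<Delta>)"
proof -
  have F: "povm F" "F UNIV = id_blinfun" using assms by (auto simp: normalized_povm_def)
  have "quad (F \<Delta>) x \<le> quad (F UNIV) x" for x
    using finite_measure.finite_measure_mono[OF finite_scalar_measure[OF F(1)], of \<Delta> UNIV x] assms
    by (simp add: measure_scalar_measure[OF F(1)])
  then show ?thesis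
    using povm_herm[OF F(1)] povm_nonneg[OF F(1)] assms F(2) by (auto simp: unit_op_def quad_id)
qed

lemma absolutely_continuous_bound:
  assumes "absolutely_continuous_povm \<nu> F" "finite_measure \<nu>"
  obtains c where "c > 0" "\<And>\<Delta>. \<Delta> \<in> sets borel \<Longrightarrow> norm (F \<Delta>) \<le> c * measure \<nu> \<Delta>"
proof -
  obtain c :: real where c: "c > 0"
    and b: "\<And>\<Delta>. \<Delta> \<in> sets borel \<Longrightarrow> ennreal (norm (F \<Delta>)) \<le> ennreal c * emeasure \<nu> \<Delta>"
    using assms(1) unfolding absolutely_continuous_povm_def by blast
  have "norm (F \<Delta>) \<le> c * measure \<nu> \<Delta>" if "\<Delta> \<in> sets borel" for \<Delta>
  proof -
    have "ennreal (norm (F \<Delta>)) \<le> ennreal (c * measure \<nu> \<Delta>)"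
      using b[OF that] c by (simp add: finite_measure.emeasure_eq_measure[OF assms(2)] ennreal_mult)
    then show ?thesis using c by (subst (asm) ennreal_le_iff) auto
  qed
  with c show ?thesis by (rule that)
qed

lemma norm_null_tendsto:
  fixes T :: "nat \<Rightarrow> 'b::real_normed_vector"
  assumes "\<And>n. norm (S - T n) \<le> c * r n" "r \<longlonglongrightarrow> (0::real)"
  shows "T \<longlonglongrightarrow> S"
proof -
  have "(\<lambda>n. c * r n) \<longlonglongrightarrow> 0" using tendsto_mult[OF tendsto_const assms(2), of c] by simp
  then have "(\<lambda>n. S - T n) \<longlonglongrightarrow> 0"
    by (rule Lim_null_comparison[rotated]) (simp add: assms(1))
  from tendsto_diff[OF tendsto_const[of S] this] show ?thesis by simp
qed

lemma commutative_povm_generator: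
  fixes F :: "real set \<Rightarrow> ('a::chilbert_space \<Rightarrow>\<^sub>L 'a)" and \<nu> :: "real measure"
  assumes F: "normalized_povm F" and \<nu>: "finite_measure \<nu>" "sets \<nu> = sets borel"
    and bd: "\<And>\<Delta>. \<Delta> \<in> sets borel \<Longrightarrow> norm (F \<Delta>) \<le> c * measure \<nu> \<Delta>"
    and comm: "commutative_povm F"
  obtains A where "unit_op A" "\<And>\<Delta>. \<Delta> \<in> sets borel \<Longrightarrow> F \<Delta> \<in> palg A"
proof -
  interpret finite_measure \<nu> by fact
  note [simp] = \<nu>(2)
  have p: "povm F" and F1: "F UNIV = id_blinfun" using F by (auto simp: normalized_povm_def)
  have F_diff: "F B - F A = F (B - A)" if "A \<subseteq> B" "A \<in> sets borel" "B \<in> sets borel" for A B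
    using povm_Un[OF p, of A "B - A"] that by (simp add: Un_absorb1)
  define T where "T k = F {..of_rat (from_nat k)}" for k
  have "unit_op (T k)" for k unfolding T_def by (rule povm_unit_op[OF F]) simp
  moreover have "T k o\<^sub>L T l = T l o\<^sub>L T k" for k l
    using comm unfolding T_def commutative_povm_def by simp
  ultimately obtain A where A: "unit_op A" "\<And>k. T k \<in> palg A" using commuting_generator by blast
  have rat: "F {..of_rat q} \<in> palg A" for q
    using A(2)[of "to_nat q"] by (simp add: T_def)
  have half: "F {..t} \<in> palg A" for t
  proof -
    have "\<exists>q. t < of_rat q \<and> of_rat q < t + 1 / real (Suc n)" for n
      by (rule of_rat_dense) simp
    then obtain q where q: "\<And>n. t < of_rat (q n)" "\<And>n. of_rat (q n) < t + 1 / real (Suc n)" by metis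
    \<comment> \<open>The rational endpoints approach \<open>t\<close> strictly from above; the
      half-open gaps lie in intervals decreasing to the empty set, so their \<nu>-measure tends to
      0.\<close>
    let ?I = "\<lambda>n. {t<..t + 1 / real (Suc n)}"
    have "(\<lambda>n. measure \<nu> (?I n)) \<longlonglongrightarrow> measure \<nu> (\<Inter>n. ?I n)"
    proof (rule finite_Lim_measure_decseq)
      show "decseq ?I"
        by (auto simp: decseq_def) (smt (verit) frac_le of_nat_le_iff of_nat_0_le_iff)
    qed auto
    moreover have "(\<Inter>n. ?I n) = {}"
    proof (rule ccontr)
      assume "\<not> ?thesis"
      then obtain s where "s \<in> (\<Inter>n. ?I n)" by blast
      then have s: "t < s" "\<And>n. s \<le> t + 1 / real (Suc n)" by auto
      from s(1) obtain n where "1 / real (Suc n) < s - t"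
        using reals_Archimedean[of "s - t"] by (auto simp: inverse_eq_divide)
      with s(2)[of n] show False by simp
    qed
    ultimately have lim: "(\<lambda>n. measure \<nu> (?I n)) \<longlonglongrightarrow> 0" by simp
    have "norm (F {..t} - F {..of_rat (q n)}) \<le> c * measure \<nu> {t<..of_rat (q n)}" for n
    proof -
      have "F {..of_rat (q n)} - F {..t} = F {t<..of_rat (q n)}"
        by (subst F_diff) (use q(1)[of n] in \<open>auto intro!: arg_cong[of _ _ F]\<close>)
      then have "norm (F {..t} - F {..of_rat (q n)}) = norm (F {t<..of_rat (q n)})"
        by (metis norm_minus_commute)
      then show ?thesis using bd by simp
    qed
    moreover have "(\<lambda>n. measure \<nu> {t<..of_rat (q n)}) \<longlonglongrightarrow> 0"
    proof (rule Lim_null_comparison[OF _ lim], intro always_eventually allI)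
      fix n
      show "norm (measure \<nu> {t<..of_rat (q n)}) \<le> measure \<nu> (?I n)"
        using q(2)[of n] by (auto intro!: finite_measure_mono)
    qed
    ultimately have "(\<lambda>n. F {..of_rat (q n)}) \<longlonglongrightarrow> F {..t}"
      by (rule norm_null_tendsto)
    then show ?thesis by (rule palg_lim[rotated]) (rule rat)
  qed
  have eq: "sets borel = sigma_sets UNIV (range (\<lambda>a::real. {..a}))"
    by (subst borel_eq_atMost) simp
  have "F \<Delta> \<in> palg A" if "\<Delta> \<in> sets borel" for \<Delta>
  proof -
    have st: "Int_stable (range (\<lambda>a::real. {..a}))"
      by (auto simp: Int_stable_def)
    have "range (\<lambda>a::real. {..a}) \<subseteq> Pow UNIV" by simp
    from st this that[unfolded eq] show ?thesis
    proof (induction rule: sigma_sets_induct_disjoint)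
      case (basic B)
      then show ?case using half by auto
    next
      case empty
      show ?case using palg_pop[of A 0] by (simp add: povm_empty[OF p])
    next
      case (compl B)
      have "B \<in> sets borel" using compl by (simp add: eq)
      then have "F (UNIV - B) = pop A 1 - F B"
        using F_diff[of B UNIV] by (simp add: F1)
      then show ?case using compl by (simp only: palg_diff palg_pop)
    next
      case (union B)
      have B: "B i \<in> sets borel" for i using union by (auto simp: eq)
      \<comment> \<open>A POVM as such gives weak convergence along these unions; the \<nu>-measure
        of what is still missing bounds the error in norm.\<close>
      let ?U = "\<lambda>n. \<Union>i<n. B i"
      have in_palg: "F (?U n) \<in> palg A" for n
      proof (induction n)
        case 0
        show ?case using palg_pop[of A 0] by (simp add: povm_empty[OF p])
      next
        case (Suc n)
        have "B n \<inter> ?U n = {}"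
          using union(1) by (auto simp: disjoint_family_on_def) (metis disjoint_iff less_irrefl)
        then have "F (?U (Suc n)) = F (B n) + F (?U n)"
          unfolding lessThan_Suc UN_insert using B by (intro povm_Un[OF p]) auto
        then show ?case using Suc union by (auto intro: palg_add)
      qed
      have U: "(\<Union>n. ?U n) = (\<Union>i. B i)" by auto
      have "(\<lambda>n. measure \<nu> (?U n)) \<longlonglongrightarrow> measure \<nu> (\<Union>n. ?U n)"
      proof (rule finite_Lim_measure_incseq)
        show "incseq ?U" by (rule monoI, rule UN_mono) auto
      qed (use B in auto)
      from tendsto_diff[OF tendsto_const this]
      have "(\<lambda>n. measure \<nu> (\<Union>i. B i) - measure \<nu> (?U n)) \<longlonglongrightarrow> 0"
        unfolding U by (metis diff_self)
      moreover have "norm (F (\<Union>i. B i) - F (?U n)) \<le> c * (measure \<nu> (\<Union>i. B i) - measure \<nu> (?U n))" for n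
      proof -
        have "F (\<Union>i. B i) - F (?U n) = F ((\<Union>i. B i) - ?U n)"
          by (rule F_diff) (use B in auto)
        moreover have "measure \<nu> ((\<Union>i. B i) - ?U n) = measure \<nu> (\<Union>i. B i) - measure \<nu> (?U n)"
          by (rule finite_measure_Diff) (use B in auto)
        moreover have "(\<Union>i. B i) - ?U n \<in> sets borel" using B by auto
        ultimately show ?thesis using bd[of "(\<Union>i. B i) - ?U n"] by simp
      qed
      ultimately have "(\<lambda>n. F (?U n)) \<longlonglongrightarrow> F (\<Union>i. B i)" by (rule norm_null_tendsto[rotated])
      then show ?case by (rule palg_lim[rotated]) (rule in_palg)
    qed
  qed
  with A(1) show ?thesis by (rule that)
qed

subsection \<open>Positive extension of continuous functions\<close>

text \<open>A variant of Dugundji's extension: the point of the explicit formula is that the extension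
  is linear and monotone in the function. Off \<open>K\<close> the value is an average of values at those
  points \<open>k n\<close> of a dense sequence of \<open>K\<close> which are at most twice as far away as \<open>K\<close>.\<close>

definition ext_weight :: "real set \<Rightarrow> (nat \<Rightarrow> real) \<Rightarrow> nat \<Rightarrow> real \<Rightarrow> real" where
  "ext_weight K k n l = (1/2)^n * max 0 (2 - dist l (k n) / infdist l K)"

definition extension :: "real set \<Rightarrow> (nat \<Rightarrow> real) \<Rightarrow> (real \<Rightarrow> real) \<Rightarrow> real \<Rightarrow> real" where
  "extension K k f l = (if l \<in> K then f l else
     (\<Sum>n. ext_weight K k n l * f (k n)) / (\<Sum>n. ext_weight K k n l))"

context
  fixes K :: "real set" and k :: "nat \<Rightarrow> real"
  assumes K: "closed K" and k: "\<And>n. k n \<in> K" and dense: "K \<subseteq> closure (range k)"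
begin

lemma infdist_pos: "l \<notin> K \<Longrightarrow> 0 < infdist l K"
  using K k[of 0] in_closed_iff_infdist_zero[of K l] infdist_nonneg[of l K] by fastforce

lemma ext_weight_nonneg: "0 \<le> ext_weight K k n l"
  by (simp add: ext_weight_def)

text \<open>Valid on \<open>K\<close> too: there \<open>infdist\<close> is 0, division by it gives
  0, and the bound is attained.\<close>

lemma ext_weight_le: "ext_weight K k n l \<le> 2 * (1/2)^n"
  by (simp add: ext_weight_def infdist_nonneg divide_right_mono)

lemma half_summable: "summable (\<lambda>n. M * (2 * (1/2 :: real)^n))"
  by (intro summable_mult summable_geometric) simp

lemma ext_weight_summable:
  assumes "\<And>t. t \<in> K \<Longrightarrow> \<bar>f t\<bar> \<le> M"
  shows "summable (\<lambda>n. ext_weight K k n l * f (k n))"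
proof (rule summable_comparison_test[OF _ half_summable[of M]], intro exI allI impI)
  fix n
  have "\<bar>ext_weight K k n l\<bar> * \<bar>f (k n)\<bar> \<le> (2 * (1/2)^n) * M"
    using assms[OF k[of n]] ext_weight_nonneg[of n l] ext_weight_le[of n l]
    by (intro mult_mono) auto
  then show "norm (ext_weight K k n l * f (k n)) \<le> M * (2 * (1/2)^n)"
    by (simp add: abs_mult mult_ac)
qed

lemma ext_weight_summable': "summable (\<lambda>n. ext_weight K k n l)"
  using ext_weight_summable[of "\<lambda>_. 1" 1 l] by simp

text \<open>With d the distance from l to \<open>K\<close>, attained at y, a member of the dense
  sequence closer than d to y is closer than 2 d to l and gets a positive weight.\<close>

lemma ext_weight_sum_pos:
  assumes l: "l \<notin> K"
  shows "0 < (\<Sum>n. ext_weight K k n l)"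
proof -
  let ?d = "infdist l K"
  have d: "0 < ?d" by (rule infdist_pos[OF l])
  have "K \<noteq> {}" using k by auto
  then obtain y where y: "y \<in> K" "?d = dist l y"
    using infdist_attains_inf[OF K] by metis
  obtain n where n: "dist (k n) y < ?d"
    using subsetD[OF dense y(1)] d unfolding closure_approachable by blast
  have "dist l (k n) \<le> dist l y + dist (k n) y" by (metis dist_commute dist_triangle)
  then have "dist l (k n) < 2 * ?d" using n y(2) by simp
  then have "0 < ext_weight K k n l" using d by (simp add: ext_weight_def divide_less_eq)
  then show ?thesis
    by (rule suminf_pos2[OF ext_weight_summable' ext_weight_nonneg])
qed

lemma extension_in: "l \<in> K \<Longrightarrow> extension K k f l = f l"
  by (simp add: extension_def)

lemma extension_const: "extension K k (\<lambda>_. c) l = c"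
  using ext_weight_sum_pos[of l]
  by (auto simp: extension_def suminf_mult2[OF ext_weight_summable', symmetric])

lemma extension_add:
  assumes "\<And>t. t \<in> K \<Longrightarrow> \<bar>f t\<bar> \<le> M" "\<And>t. t \<in> K \<Longrightarrow> \<bar>g t\<bar> \<le> N"
  shows "extension K k (\<lambda>t. f t + g t) l = extension K k f l + extension K k g l"
  using suminf_add[OF ext_weight_summable[of f M l] ext_weight_summable[of g N l]] assms
  by (auto simp: extension_def distrib_left simp flip: add_divide_distrib)

lemma extension_mono:
  assumes "\<And>t. t \<in> K \<Longrightarrow> \<bar>f t\<bar> \<le> M" "\<And>t. t \<in> K \<Longrightarrow> \<bar>g t\<bar> \<le> N" "\<And>t. t \<in> K \<Longrightarrow> f t \<le> g t"
  shows "extension K k f l \<le> extension K k g l"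
proof (cases "l \<in> K")
  case False
  have "(\<Sum>n. ext_weight K k n l * f (k n)) \<le> (\<Sum>n. ext_weight K k n l * g (k n))"
    using assms(1,2)
    by (intro suminf_le ext_weight_summable[of f M] ext_weight_summable[of g N] mult_left_mono
        ext_weight_nonneg assms(3) k)
  then show ?thesis
    using False ext_weight_sum_pos[OF False] by (simp add: extension_def divide_right_mono)
qed (simp add: extension_in assms)

lemma extension_cong:
  assumes "\<And>t. t \<in> K \<Longrightarrow> f t = g t"
  shows "extension K k f l = extension K k g l"
  using assms k by (simp add: extension_def)

lemma continuous_ext_sum:
  assumes "\<And>t. t \<in> K \<Longrightarrow> \<bar>f t\<bar> \<le> M"
  shows "continuous_on (- K) (\<lambda>l. \<Sum>n. ext_weight K k n l * f (k n))"
proof (rule uniform_limit_theorem)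
  show "uniform_limit (- K) (\<lambda>N l. \<Sum>n<N. ext_weight K k n l * f (k n))
      (\<lambda>l. \<Sum>n. ext_weight K k n l * f (k n)) sequentially"
  proof (rule Weierstrass_m_test[OF _ half_summable[of M]])
    fix n l
    have "\<bar>ext_weight K k n l\<bar> * \<bar>f (k n)\<bar> \<le> (2 * (1/2)^n) * M"
      using assms[OF k[of n]] ext_weight_nonneg[of n l] ext_weight_le[of n l]
      by (intro mult_mono) auto
    then show "norm (ext_weight K k n l * f (k n)) \<le> M * (2 * (1/2)^n)"
      by (simp add: abs_mult mult_ac)
  qed
  show "\<forall>\<^sub>F N in sequentially. continuous_on (- K) (\<lambda>l. \<Sum>n<N. ext_weight K k n l * f (k n))"
    unfolding ext_weight_def using infdist_pos
    by (intro always_eventually allI continuous_intros) force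
qed simp

lemma continuous_extension:
  assumes bd: "\<And>t. t \<in> K \<Longrightarrow> \<bar>f t\<bar> \<le> M" and f: "continuous_on K f"
  shows "continuous_on UNIV (extension K k f)"
proof -
  let ?w = "\<lambda>l. \<Sum>n. ext_weight K k n l"
  have off: "isCont (extension K k f) l" if l: "l \<notin> K" for l
  proof -
    have "continuous_on (- K) ?w" using continuous_ext_sum[of "\<lambda>_. 1" 1] by simp
    then have "continuous_on (- K) (\<lambda>l. (\<Sum>n. ext_weight K k n l * f (k n)) / ?w l)"
      using ext_weight_sum_pos continuous_ext_sum[OF bd]
      by (intro continuous_on_divide) (auto simp: less_le)
    then have "continuous_on (- K) (extension K k f)"
      by (rule continuous_on_eq) (simp add: extension_def)
    then show ?thesis using K l by (simp add: continuous_on_eq_continuous_at open_Compl)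
  qed
  have on: "isCont (extension K k f) l" if l: "l \<in> K" for l
    unfolding continuous_at_eps_delta
  proof (intro allI impI)
    fix e :: real assume e: "e > 0"
    then obtain d where d: "d > 0" and fd: "\<And>t. t \<in> K \<Longrightarrow> dist t l < d \<Longrightarrow> dist (f t) (f l) < e / 2"
      using f l unfolding continuous_on_iff by (metis half_gt_zero)
    \<comment> \<open>The third of d: a point \<open>k n\<close> with nonzero weight at
      \<open>l'\<close> is closer than 2 |l' - l| to \<open>l'\<close>, hence closer than 3 |l' - l|
      < d to \<open>l\<close>.\<close>
    have "dist (extension K k f l') (extension K k f l) < e" if l': "dist l' l < d / 3" for l'
    proof (cases "l' \<in> K")
      case True
      then have "dist (f l') (f l) < e / 2" using fd[of l'] l' d by simp
      then show ?thesis using True l e by (simp add: extension_in)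
    next
      case False
      let ?a = "\<lambda>n. ext_weight K k n l'"
      have sg: "summable (\<lambda>n. ?a n * (f (k n) - f l))"
        by (rule ext_weight_summable[where M="M + \<bar>f l\<bar>"]) (use bd in \<open>fastforce\<close>)
      have "\<bar>?a n * (f (k n) - f l)\<bar> \<le> ?a n * (e / 2)" for n
      proof (cases "?a n = 0")
        case False
        then have "dist l' (k n) / infdist l' K < 2" by (auto simp: ext_weight_def)
        then have "dist l' (k n) < 2 * infdist l' K"
          using infdist_pos[OF \<open>l' \<notin> K\<close>] by (simp add: divide_less_eq)
        also have "\<dots> \<le> 2 * dist l' l" using infdist_le[OF l, of l'] by simp
        finally have "dist (k n) l < d"
          using l' dist_triangle[of "k n" l l'] by (simp add: dist_commute)
        then have "\<bar>f (k n) - f l\<bar> \<le> e / 2" using fd[OF k] by (fastforce simp: dist_real_def)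
        then show ?thesis
          unfolding abs_mult abs_of_nonneg[OF ext_weight_nonneg]
          by (intro mult_left_mono ext_weight_nonneg)
      qed simp
      note le = this
      have sa: "summable (\<lambda>n. ?a n * (e / 2))" by (intro summable_mult2 ext_weight_summable')
      have "\<bar>\<Sum>n. ?a n * (f (k n) - f l)\<bar> \<le> (\<Sum>n. ?a n * (e / 2))"
      proof -
        have "summable (\<lambda>n. \<bar>?a n * (f (k n) - f l)\<bar>)"
          by (rule summable_comparison_test[OF _ sa]) (use le in auto)
        then show ?thesis
          by (intro order_trans[OF summable_rabs] suminf_le le sa)
      qed
      also have "\<dots> = ?w l' * (e / 2)" by (rule suminf_mult2[OF ext_weight_summable', symmetric])
      finally have b: "\<bar>\<Sum>n. ?a n * (f (k n) - f l)\<bar> \<le> ?w l' * (e / 2)" .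
      \<comment> \<open>After division by the total weight, the error at \<open>l'\<close> is the
        weighted mean of the differences f (k n) - f l.\<close>
      have "(\<Sum>n. ?a n * (f (k n) - f l)) = (\<Sum>n. ?a n * f (k n)) - ?w l' * f l"
        using suminf_diff[OF ext_weight_summable[of f M l', OF bd] summable_mult2[OF ext_weight_summable', of l' "f l"]]
          suminf_mult2[OF ext_weight_summable', of l' "f l"] by (simp add: right_diff_distrib)
      also have "\<dots> = ?w l' * (extension K k f l' - f l)"
        using False ext_weight_sum_pos[OF False] by (simp add: extension_def field_simps)
      finally have "?w l' * \<bar>extension K k f l' - f l\<bar> \<le> ?w l' * (e / 2)"
        using b ext_weight_sum_pos[OF False] by (simp add: abs_mult)
      then have "\<bar>extension K k f l' - f l\<bar> \<le> e / 2"
        using ext_weight_sum_pos[OF False] by simp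
      then show ?thesis using e l by (simp add: extension_in dist_real_def)
    qed
    then show "\<exists>d>0. \<forall>x'. dist x' l < d \<longrightarrow> dist (extension K k f x') (extension K k f l) < e"
      using d by (intro exI[of _ "d/3"]) auto
  qed
  show ?thesis
    by (intro continuous_at_imp_continuous_on ballI) (use on off in blast)
qed

end

subsection \<open>The support of a projection-valued measure\<close>

definition pvm_support :: "(real set \<Rightarrow> ('a::chilbert_space \<Rightarrow>\<^sub>L 'a)) \<Rightarrow> real set" where
  "pvm_support E = {l. \<forall>e>0. E (ball l e) \<noteq> 0}"

lemma pvm_povm: "pvm E \<Longrightarrow> povm E"
  by (simp add: pvm_def normalized_povm_def)

lemma measure_scalar_UNIV:
  assumes "pvm E"
  shows "measure (scalar_measure E x) UNIV = (norm x)\<^sup>2"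
  using assms by (simp add: measure_scalar_measure[OF pvm_povm] pvm_def normalized_povm_def quad_id)

lemma povm_null_mono:
  assumes E: "povm E" and AB: "A \<subseteq> B" "A \<in> sets borel" "B \<in> sets borel" "E B = 0"
  shows "E A = 0"
proof (rule herm_eqI)
  fix x
  have "quad (E A) x \<le> quad (E B) x"
    using finite_measure.finite_measure_mono[OF finite_scalar_measure[OF E], of A B x] AB
    by (simp add: measure_scalar_measure[OF E])
  then show "quad (E A) x = quad 0 x"
    using povm_nonneg[OF E AB(2), of x] AB(4) by (simp add: quad_zero)
qed (use AB povm_herm[OF E] in auto)

lemma closed_pvm_support:
  assumes E: "povm E"
  shows "closed (pvm_support E)"
  unfolding closed_def open_contains_ball
proof
  fix l assume "l \<in> - pvm_support E"
  then obtain e where e: "e > 0" "E (ball l e) = 0" by (auto simp: pvm_support_def)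
  have "ball l e \<subseteq> - pvm_support E"
  proof
    fix l' assume l': "l' \<in> ball l e"
    then have "ball l' (e - dist l l') \<subseteq> ball l e"
      by (auto simp: dist_real_def)
    then have "E (ball l' (e - dist l l')) = 0" by (rule povm_null_mono[OF E _ _ _ e(2)]) auto
    then show "l' \<in> - pvm_support E" using l' by (force simp: pvm_support_def)
  qed
  with e show "\<exists>e>0. ball l e \<subseteq> - pvm_support E" by blast
qed

text \<open>The complement is covered by null balls, and Lindelof reduces them to countably
  many.\<close>

lemma AE_pvm_support:
  assumes E: "povm E"
  shows "AE t in scalar_measure E x. t \<in> pvm_support E"
proof -
  define B where "B = {ball l e | l e. e > 0 \<and> E (ball l e) = 0}"
  have "- pvm_support E \<subseteq> \<Union>B"
    by (auto simp: pvm_support_def B_def) (metis centre_in_ball)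
  obtain B' where B': "B' \<subseteq> B" "countable B'" "\<Union>B' = \<Union>B"
    by (rule Lindelof[of B]) (auto simp: B_def)
  have "b \<in> null_sets (scalar_measure E x)" if "b \<in> B'" for b
    using B' that by (auto simp: B_def null_sets_def emeasure_scalar_measure[OF E] quad_zero)
  then have "\<Union>B' \<in> null_sets (scalar_measure E x)"
    using null_sets_UN'[OF B'(2), of "\<lambda>b. b"] by simp
  then have "AE t in scalar_measure E x. t \<notin> \<Union>B'" by (rule AE_not_in)
  then show ?thesis
    by (rule eventually_mono) (use \<open>- pvm_support E \<subseteq> \<Union>B\<close> B'(3) in blast)
qed

text \<open>If g l < 0, then g is at most g l / 2 on the support near l. The scalar measure of a
  nonzero vector in the range of E of a small ball lives on that ball, so its integral of g would be
  negative.\<close>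

lemma pvm_nonneg_on_support:
  fixes g :: "real \<Rightarrow> real"
  assumes E: "pvm E" and g: "continuous_on (pvm_support E) g"
    and i: "\<And>x. integrable (scalar_measure E x) g"
    and nn: "\<And>x. 0 \<le> (\<integral>t. g t \<partial>scalar_measure E x)"
    and l: "l \<in> pvm_support E"
  shows "0 \<le> g l"
proof (rule ccontr)
  assume "\<not> 0 \<le> g l"
  then have neg: "g l < 0" by simp
  note p = pvm_povm[OF E]
  obtain e where e: "e > 0" and ge: "\<And>t. t \<in> pvm_support E \<Longrightarrow> dist t l < e \<Longrightarrow> dist (g t) (g l) < - g l / 2"
    using g l neg unfolding continuous_on_iff by (metis half_gt_zero neg_0_less_iff_less)
  have "E (ball l e) \<noteq> 0" using l e by (simp add: pvm_support_def)
  then obtain y where y: "E (ball l e) y \<noteq> 0" by (metis blinfun_eqI zero_blinfun.rep_eq)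
  define x where "x = E (ball l e) y"
  have "E (ball l e) o\<^sub>L E (ball l e) = E (ball l e)" using E by (simp add: pvm_def)
  then have Ex: "E (ball l e) x = x" unfolding x_def by (metis blinfun_apply_blinfun_compose)
  let ?M = "scalar_measure E x"
  interpret finite_measure ?M by (rule finite_scalar_measure[OF p])
  have "measure ?M (UNIV - ball l e) = 0"
    using finite_measure_compl[of "ball l e"] Ex
    by (simp add: measure_scalar_UNIV[OF E]) (simp add: measure_scalar_measure[OF p] quad_def Re_cinner_self)
  then have "UNIV - ball l e \<in> null_sets ?M"
    by (intro null_setsI) (simp_all add: emeasure_eq_measure)
  then have "AE t in ?M. t \<notin> UNIV - ball l e" by (rule AE_not_in)
  with AE_pvm_support[OF p, of x] have "AE t in ?M. g t \<le> g l / 2"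
  proof (eventually_elim)
    case (elim t)
    then have "dist (g t) (g l) < - g l / 2" by (intro ge) (auto simp: dist_commute)
    then show ?case by (simp add: dist_real_def abs_less_iff)
  qed
  then have "(\<integral>t. g t \<partial>?M) \<le> (\<integral>t. g l / 2 \<partial>?M)"
    by (intro integral_mono_AE i) auto
  also have "\<dots> = (g l / 2) * (norm x)\<^sup>2" by (simp add: measure_scalar_UNIV[OF E])
  also have "\<dots> < 0" using neg y by (simp add: x_def mult_neg_pos)
  finally show False using nn[of x] by simp
qed

lemma pvm_eq_on_support:
  fixes f g :: "real \<Rightarrow> real"
  assumes E: "pvm E" and c: "continuous_on (pvm_support E) f" "continuous_on (pvm_support E) g"
    and i: "\<And>x. integrable (scalar_measure E x) f" "\<And>x. integrable (scalar_measure E x) g"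
    and eq: "\<And>x. (\<integral>t. f t \<partial>scalar_measure E x) = (\<integral>t. g t \<partial>scalar_measure E x)"
    and l: "l \<in> pvm_support E"
  shows "f l = g l"
proof -
  have "0 \<le> f l - g l"
    by (rule pvm_nonneg_on_support[OF E _ _ _ l, of "\<lambda>t. f t - g t"])
      (use c i eq in \<open>auto intro!: continuous_intros\<close>)
  moreover have "0 \<le> g l - f l"
    by (rule pvm_nonneg_on_support[OF E _ _ _ l, of "\<lambda>t. g t - f t"])
      (use c i eq in \<open>auto intro!: continuous_intros\<close>)
  ultimately show ?thesis by simp
qed

subsection \<open>Continuous functions of an operator\<close>

text \<open>Positivity on the support, applied to |p(A)| - p and |p(A)| + p, bounds a polynomial
  there by the norm of its operator. Norm convergence of polynomials in \<open>A\<close> thus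
  becomes uniform convergence on the support, which preserves continuity.\<close>

lemma palg_function:
  fixes A :: "'a::chilbert_space \<Rightarrow>\<^sub>L 'a"
  assumes E: "pvm E" and AE01: "\<And>x. AE t in scalar_measure E x. t \<in> {0..1}"
    and poly: "\<And>x p. (\<integral>t. poly p t \<partial>scalar_measure E x) = quad (pop A p) x"
    and T: "T \<in> palg A"
  shows "\<exists>f. f \<in> borel_measurable borel \<and> continuous_on (pvm_support E) f \<and>
    (\<forall>t. \<bar>f t\<bar> \<le> norm T) \<and> (\<forall>x. (\<integral>t. f t \<partial>scalar_measure E x) = quad T x)"
proof -
  note p = pvm_povm[OF E]
  let ?K = "pvm_support E"
  have K: "closed ?K" by (rule closed_pvm_support[OF p])
  have ip: "integrable (scalar_measure E x) (poly q)" for x and q :: "real poly"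
    by (rule integrable_unit_interval[OF finite_scalar_measure[OF p] _ AE01]) (auto intro!: continuous_intros)
  have ic: "integrable (scalar_measure E x) (\<lambda>_. c)" for x and c :: real
    using finite_scalar_measure[OF p] by (simp add: finite_measure.integrable_const)
  have bound: "\<bar>poly q l\<bar> \<le> norm (pop A q)" if l: "l \<in> ?K" for q l
  proof -
    have q: "\<bar>quad (pop A q) x\<bar> \<le> norm (pop A q) * (norm x)\<^sup>2" for x by (rule abs_quad_le)
    have "0 \<le> norm (pop A q) - poly q l"
    proof (rule pvm_nonneg_on_support[OF E _ _ _ l])
      show "0 \<le> (\<integral>t. norm (pop A q) - poly q t \<partial>scalar_measure E x)" for x
        using q[of x] by (simp add: ip ic poly measure_scalar_UNIV[OF E] abs_le_iff mult.commute)
    qed (auto intro!: continuous_intros ip ic)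
    moreover have "0 \<le> norm (pop A q) + poly q l"
    proof (rule pvm_nonneg_on_support[OF E _ _ _ l])
      show "0 \<le> (\<integral>t. norm (pop A q) + poly q t \<partial>scalar_measure E x)" for x
        using q[of x] by (simp add: ip ic poly measure_scalar_UNIV[OF E] abs_le_iff mult.commute)
    qed (auto intro!: continuous_intros ip ic)
    ultimately show ?thesis by (simp add: abs_le_iff)
  qed
  obtain q where q: "(\<lambda>n. pop A (q n)) \<longlonglongrightarrow> T" using T by (auto simp: palg_sequential)
  \<comment> \<open>Cutting off by the indicator makes the convergence uniform on the whole line and
    the limit Borel; off the support the limit is 0.\<close>
  define u where "u n t = indicator ?K t * poly (q n) t" for n t
  have ule: "\<bar>u n t\<bar> \<le> norm (pop A (q n))" for n t
    using bound[of t "q n"] by (auto simp: u_def indicator_def)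
  have "uniformly_Cauchy_on UNIV u"
    unfolding uniformly_Cauchy_on_def
  proof (intro allI impI)
    fix e :: real assume "e > 0"
    then obtain N where N: "\<And>m n. m \<ge> N \<Longrightarrow> n \<ge> N \<Longrightarrow> dist (pop A (q m)) (pop A (q n)) < e"
      using metric_CauchyD[OF LIMSEQ_imp_Cauchy[OF q]] by blast
    have "dist (u m t) (u n t) < e" if "m \<ge> N" "n \<ge> N" for m n t
    proof -
      have "dist (u m t) (u n t) \<le> norm (pop A (q m - q n))"
        using bound[of t "q m - q n"] by (auto simp: u_def indicator_def dist_real_def)
      also have "\<dots> < e" using N[OF that] by (simp add: dist_norm pop_diff)
      finally show ?thesis .
    qed
    then show "\<exists>M. \<forall>x\<in>UNIV. \<forall>m\<ge>M. \<forall>n\<ge>M. dist (u m x) (u n x) < e" by blast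
  qed
  then have "uniformly_convergent_on UNIV u" by (rule Cauchy_uniformly_convergent)
  then obtain f where f: "uniform_limit UNIV u f sequentially"
    by (auto simp: uniformly_convergent_on_def)
  have lim: "(\<lambda>n. u n t) \<longlonglongrightarrow> f t" for t using tendsto_uniform_limitI[OF f] by simp
  have um: "u n \<in> borel_measurable borel" for n
    using K unfolding u_def by (intro borel_measurable_times borel_measurable_indicator) auto
  have fm: "f \<in> borel_measurable borel"
    by (rule borel_measurable_LIMSEQ_real[OF lim um])
  have "continuous_on ?K f"
  proof (rule uniform_limit_theorem)
    show "uniform_limit ?K u f sequentially" by (rule uniform_limit_on_subset[OF f]) simp
    have "continuous_on ?K (u n)" for n
      by (rule continuous_on_eq[of _ "poly (q n)"]) (auto simp: u_def intro!: continuous_intros)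
    then show "\<forall>\<^sub>F n in sequentially. continuous_on ?K (u n)" by simp
  qed simp
  moreover have "\<bar>f t\<bar> \<le> norm T" for t
    by (rule LIMSEQ_le[OF tendsto_rabs[OF lim] tendsto_norm[OF q]]) (use ule in auto)
  moreover have "(\<integral>t. f t \<partial>scalar_measure E x) = quad T x" for x
  proof (rule LIMSEQ_unique)
    have "Bseq (\<lambda>n. pop A (q n))" using q by (rule convergentI[THEN convergent_imp_Bseq])
    then obtain C where C: "\<And>n. norm (pop A (q n)) \<le> C" by (auto simp: Bseq_def)
    show "(\<lambda>n. \<integral>t. u n t \<partial>scalar_measure E x) \<longlonglongrightarrow> (\<integral>t. f t \<partial>scalar_measure E x)"
      by (rule integral_dominated_convergence[where w="\<lambda>_. C"])
        (use um fm lim ic order_trans[OF ule C] in \<open>auto cong: measurable_cong_sets\<close>)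
    have "(\<integral>t. u n t \<partial>scalar_measure E x) = quad (pop A (q n)) x" for n
    proof -
      have "(\<integral>t. u n t \<partial>scalar_measure E x) = (\<integral>t. poly (q n) t \<partial>scalar_measure E x)"
        by (rule integral_cong_AE)
          (use AE_pvm_support[OF p, of x] um[unfolded u_def] in \<open>auto simp: u_def elim!: AE_mp cong: measurable_cong_sets\<close>)
      then show ?thesis by (simp add: poly)
    qed
    then show "(\<lambda>n. \<integral>t. u n t \<partial>scalar_measure E x) \<longlonglongrightarrow> quad T x"
      using quad_tendsto[of "\<lambda>n. pop A (q n)" T x] blinfun.tendsto[OF q tendsto_const] by simp
  qed
  ultimately show ?thesis using fm by blast
qed

section \<open>From continuous functions to spectral integrals and kernels\<close>

lemma has_spectral_integralI:
  fixes T :: "'a::chilbert_space \<Rightarrow>\<^sub>L 'a"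
  assumes "herm T" "f \<in> borel_measurable borel"
    "\<And>x. integrable (scalar_measure E x) (\<lambda>t. (f t)\<^sup>2)"
    "\<And>x. (\<integral>t. f t \<partial>scalar_measure E x) = quad T x"
  shows "has_spectral_integral E f UNIV (blinfun_apply T)"
  using assms by (simp add: has_spectral_integral_def herm_clinear cinner_herm_real)

text \<open>Finite additivity becomes countable additivity by continuity at the empty set, which
  domination by c \<nu> provides at every \<open>l\<close>. Continuity in \<open>l\<close> yields
  measurability of the kernel.\<close>

lemma kernel_from_bounded_additive:
  fixes h :: "real set \<Rightarrow> real \<Rightarrow> real"
  assumes \<nu>: "finite_measure \<nu>" "sets \<nu> = sets borel"
    and nn: "\<And>\<Delta> l. \<Delta> \<in> sets borel \<Longrightarrow> 0 \<le> h \<Delta> l"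
    and bd: "\<And>\<Delta> l. \<Delta> \<in> sets borel \<Longrightarrow> h \<Delta> l \<le> c * measure \<nu> \<Delta>"
    and add: "\<And>A B l. A \<in> sets borel \<Longrightarrow> B \<in> sets borel \<Longrightarrow> A \<inter> B = {} \<Longrightarrow> h (A \<union> B) l = h A l + h B l"
    and one: "\<And>l. h UNIV l = 1"
    and cont: "\<And>\<Delta>. \<Delta> \<in> sets borel \<Longrightarrow> continuous_on UNIV (h \<Delta>)"
  obtains \<mu> where "markov_kernel \<mu>" "strong_feller \<mu>"
    "\<And>\<Delta> l. \<Delta> \<in> sets borel \<Longrightarrow> measure (\<mu> l) \<Delta> = h \<Delta> l"
proof -
  interpret \<nu>: finite_measure \<nu> by fact
  define \<mu> where "\<mu> l = measure_of UNIV (sets borel) (\<lambda>\<Delta>. ennreal (h \<Delta> l))" for l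
  have s: "sets (\<mu> l) = sets borel" for l
    unfolding \<mu>_def by (subst sets_measure_of) (auto simp: sets.sigma_sets_eq[of borel, simplified])
  have sp: "space (\<mu> l) = UNIV" for l
    unfolding \<mu>_def by (subst space_measure_of) auto
  have em: "emeasure (\<mu> l) \<Delta> = ennreal (h \<Delta> l)" if \<Delta>: "\<Delta> \<in> sets borel" for \<Delta> l
  proof (rule emeasure_measure_of[OF \<mu>_def])
    interpret sigma_algebra UNIV "sets borel :: real set set"
      using sets.sigma_algebra_axioms[of "borel :: real measure"] by simp
    have h0: "h {} l = 0" using add[of "{}" "{}" l] by simp
    show pos: "positive (sets (\<mu> l)) (\<lambda>\<Delta>. ennreal (h \<Delta> l))"
      by (simp add: positive_def h0)
    have ca: "countably_additive (sets borel) (\<lambda>\<Delta>. ennreal (h \<Delta> l))"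
    proof (rule empty_continuous_imp_countably_additive)
      show "positive (sets borel) (\<lambda>\<Delta>. ennreal (h \<Delta> l))" using pos by (simp add: s)
      show "additive (sets borel) (\<lambda>\<Delta>. ennreal (h \<Delta> l))"
        by (auto simp: additive_def add nn ennreal_plus)
      show "\<forall>A\<in>sets borel. ennreal (h A l) \<noteq> \<infinity>" by simp
      fix B :: "nat \<Rightarrow> real set"
      assume B: "range B \<subseteq> sets borel" "decseq B" "(\<Inter>i. B i) = {}"
      have "(\<lambda>i. measure \<nu> (B i)) \<longlonglongrightarrow> measure \<nu> (\<Inter>i. B i)"
        using B \<nu>(2) by (intro \<nu>.finite_Lim_measure_decseq) auto
      then have "(\<lambda>i. c * measure \<nu> (B i)) \<longlonglongrightarrow> 0"
        using B(3) tendsto_mult[OF tendsto_const, of _ 0 _ c] by simp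
      then have "(\<lambda>i. h (B i) l) \<longlonglongrightarrow> 0"
        by (rule Lim_null_comparison[rotated])
          (use B nn bd in \<open>auto intro!: always_eventually simp: subset_eq\<close>)
      then show "(\<lambda>i. ennreal (h (B i) l)) \<longlonglongrightarrow> 0"
        using tendsto_ennrealI by fastforce
    qed
    then show "countably_additive (sets (\<mu> l)) (\<lambda>\<Delta>. ennreal (h \<Delta> l))" by (simp add: s)
  qed (use \<Delta> s in auto)
  have prob: "prob_space (\<mu> l)" for l
    by (rule prob_spaceI) (simp add: sp em one)
  have m: "measure (\<mu> l) \<Delta> = h \<Delta> l" if "\<Delta> \<in> sets borel" for \<Delta> l
    using that by (simp add: measure_def em nn)
  have "markov_kernel \<mu>"
    unfolding markov_kernel_def
  proof (rule measurable_prob_algebraI[OF prob])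
    show "\<mu> \<in> borel \<rightarrow>\<^sub>M subprob_algebra borel"
    proof (rule measurable_subprob_algebra)
      show "subprob_space (\<mu> l)" for l by (rule prob_space_imp_subprob_space[OF prob])
      show "(\<lambda>l. emeasure (\<mu> l) \<Delta>) \<in> borel_measurable borel" if "\<Delta> \<in> sets borel" for \<Delta>
        using borel_measurable_continuous_onI[OF cont[OF that]] by (simp add: em[OF that])
    qed (rule s)
  qed
  moreover have "strong_feller \<mu>"
    unfolding strong_feller_def by (simp add: m cont)
  ultimately show ?thesis using m by (rule that)
qed

subsection \<open>From commutativity to a strong Feller kernel\<close>

lemma integral_const_scalar_measure:
  assumes "pvm E"
  shows "(\<integral>t. (c::real) \<partial>scalar_measure E x) = c * (norm x)\<^sup>2"
proof -
  interpret finite_measure "scalar_measure E x" by (rule finite_scalar_measure[OF pvm_povm[OF assms]])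
  show ?thesis by (simp add: measure_scalar_UNIV[OF assms])
qed

lemma commutative_imp_strong_feller:
  fixes F :: "real set \<Rightarrow> ('a::chilbert_space \<Rightarrow>\<^sub>L 'a)" and \<nu> :: "real measure"
  assumes F: "normalized_povm F" and \<nu>: "finite_measure \<nu>" "sets \<nu> = sets borel"
    and ac: "absolutely_continuous_povm \<nu> F" and comm: "commutative_povm F"
  shows "\<exists>D A E \<mu>. self_adjoint D A \<and> is_spectral_measure E D A \<and>
       markov_kernel \<mu> \<and> strong_feller \<mu> \<and>
       (\<forall>\<Delta>\<in>sets borel.
          has_spectral_integral E (\<lambda>l. measure (\<mu> l) \<Delta>) UNIV (blinfun_apply (F \<Delta>)))"
proof -
  have pF: "povm F" and F1: "F UNIV = id_blinfun" using F by (auto simp: normalized_povm_def)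
  obtain c where c: "c > 0" and bd: "\<And>\<Delta>. \<Delta> \<in> sets borel \<Longrightarrow> norm (F \<Delta>) \<le> c * measure \<nu> \<Delta>"
    using absolutely_continuous_bound[OF ac \<nu>(1)] by blast
  obtain A where A: "unit_op A" and FA: "\<And>\<Delta>. \<Delta> \<in> sets borel \<Longrightarrow> F \<Delta> \<in> palg A"
    using commutative_povm_generator[OF F \<nu> bd comm] by blast
  obtain E where E: "pvm E" and AE01: "\<And>x. AE t in scalar_measure E x. t \<in> {0..1}"
    and poly: "\<And>x p. (\<integral>t. poly p t \<partial>scalar_measure E x) = quad (pop A p) x"
    by (rule spectral_theorem[OF A]) (rule that)
  note p = pvm_povm[OF E]
  let ?K = "pvm_support E"
  have hA: "herm A" using A by (simp add: unit_op_def)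
  have integrable_cont: "integrable (scalar_measure E x) f" if "continuous_on UNIV f" for f :: "real \<Rightarrow> real" and x
    by (rule integrable_unit_interval[OF finite_scalar_measure[OF p] _ AE01 that]) simp
  have integrable_bd: "integrable (scalar_measure E x) f"
    if "f \<in> borel_measurable borel" "\<And>t. \<bar>f t\<bar> \<le> C" for f :: "real \<Rightarrow> real" and C x
    by (rule finite_measure.integrable_const_bound[OF finite_scalar_measure[OF p], of _ C])
      (use that in \<open>auto cong: measurable_cong_sets\<close>)
  have spA: "is_spectral_measure E UNIV (blinfun_apply A)"
    unfolding is_spectral_measure_def
  proof (intro conjI E has_spectral_integralI hA)
    show "(\<integral>t. t \<partial>scalar_measure E x) = quad A x" for x
      using poly[of x "[:0,1:]"] pop_X[of A] by simp
    show "integrable (scalar_measure E x) (\<lambda>t. t\<^sup>2)" for x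
      by (intro integrable_cont continuous_intros)
  qed simp
  have "\<exists>\<mu>. markov_kernel \<mu> \<and> strong_feller \<mu> \<and>
    (\<forall>\<Delta>\<in>sets borel. \<forall>x. (\<integral>l. measure (\<mu> l) \<Delta> \<partial>scalar_measure E x) = quad (F \<Delta>) x)"
  \<comment> \<open>With empty support all scalar measures vanish and the space is trivial, so the
    constant Dirac measure at 0 serves as kernel. Otherwise the support has a dense sequence, as the
    extension requires.\<close>
  proof (cases "?K = {}")
    case True
    have AEF: "AE t in scalar_measure E x. False" for x
      using AE_pvm_support[OF p, of x] True by simp
    have x0: "x = 0" for x :: 'a
    proof -
      have "(\<integral>t. (1::real) \<partial>scalar_measure E x) = (\<integral>t. 0 \<partial>scalar_measure E x)"
        by (rule integral_cong_AE) (use AEF[of x] in \<open>auto elim: AE_mp\<close>)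
      then show ?thesis unfolding integral_const_scalar_measure[OF E] by simp
    qed
    have mk: "(\<lambda>l::real. return borel (0::real)) \<in> borel \<rightarrow>\<^sub>M prob_algebra borel"
      by (rule measurable_const) (simp add: space_prob_algebra prob_space_return)
    have int0: "(\<integral>l. g l \<partial>scalar_measure E x) = quad (F \<Delta>) x" if "g \<in> borel_measurable borel" for g :: "real \<Rightarrow> real" and x \<Delta>
    proof -
      have "(\<integral>l. g l \<partial>scalar_measure E x) = (\<integral>t. 0 \<partial>scalar_measure E x)"
        by (rule integral_cong_AE) (use AEF[of x] that in \<open>auto elim: AE_mp cong: measurable_cong_sets\<close>)
      then show ?thesis using x0[of x] by (simp add: quad_def)
    qed
    show ?thesis
    proof (intro exI conjI ballI allI)
      show "markov_kernel (\<lambda>l. return borel 0)" using mk by (simp add: markov_kernel_def)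
      show "strong_feller (\<lambda>l. return borel 0)" by (simp add: strong_feller_def)
    qed (rule int0, simp)
  next
    case False
    obtain S where S: "countable S" "S \<subseteq> ?K" "?K \<subseteq> closure S" using separable[of ?K] by blast
    have "S \<noteq> {}" using S(3) False by auto
    define k where "k = from_nat_into S"
    have range_k: "range k = S" unfolding k_def by (rule range_from_nat_into) fact+
    have kK: "k n \<in> ?K" for n using range_k S(2) by blast
    have dense: "?K \<subseteq> closure (range k)" using S(3) by (simp add: range_k)
    have K: "closed ?K" by (rule closed_pvm_support[OF p])
    note ext = extension_in[OF K kK dense] extension_const[OF K kK dense] extension_add[OF K kK dense]
      extension_mono[OF K kK dense] extension_cong[OF K kK dense] continuous_extension[OF K kK dense]
    have "\<forall>\<Delta>. \<exists>f. \<Delta> \<in> sets borel \<longrightarrow> f \<in> borel_measurable borel \<and> continuous_on ?K f \<and>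
      (\<forall>t. \<bar>f t\<bar> \<le> norm (F \<Delta>)) \<and> (\<forall>x. (\<integral>t. f t \<partial>scalar_measure E x) = quad (F \<Delta>) x)"
      using palg_function[OF E AE01 poly FA] by blast
    then obtain f where f: "\<And>\<Delta>. \<Delta> \<in> sets borel \<Longrightarrow> f \<Delta> \<in> borel_measurable borel"
      "\<And>\<Delta>. \<Delta> \<in> sets borel \<Longrightarrow> continuous_on ?K (f \<Delta>)"
      "\<And>\<Delta> t. \<Delta> \<in> sets borel \<Longrightarrow> \<bar>f \<Delta> t\<bar> \<le> norm (F \<Delta>)"
      "\<And>\<Delta> x. \<Delta> \<in> sets borel \<Longrightarrow> (\<integral>t. f \<Delta> t \<partial>scalar_measure E x) = quad (F \<Delta>) x"
      by (metis choice)
    have fi: "integrable (scalar_measure E x) (f \<Delta>)" if "\<Delta> \<in> sets borel" for \<Delta> x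
      by (rule integrable_bd[OF f(1,3)[OF that]])
    \<comment> \<open>Relations between operators become pointwise relations on the support only,
      where the integrals against all scalar measures determine a continuous function.\<close>
    have f_nonneg: "0 \<le> f \<Delta> l" if "\<Delta> \<in> sets borel" "l \<in> ?K" for \<Delta> l
      by (rule pvm_nonneg_on_support[OF E f(2)[OF that(1)] fi[OF that(1)] _ that(2)])
        (simp only: f(4)[OF that(1)] povm_nonneg[OF pF that(1)])
    have f_add: "f (X \<union> Y) l = f X l + f Y l"
      if X: "X \<in> sets borel" and Y: "Y \<in> sets borel" and XY: "X \<inter> Y = {}" and l: "l \<in> ?K" for X Y l
    proof (rule pvm_eq_on_support[OF E f(2) _ fi _ _ l, of _ "\<lambda>t. f X t + f Y t"])
      show "continuous_on ?K (\<lambda>t. f X t + f Y t)" by (intro continuous_on_add f(2) X Y)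
      show "integrable (scalar_measure E x) (\<lambda>t. f X t + f Y t)" for x
        by (intro Bochner_Integration.integrable_add fi X Y)
      show "(\<integral>t. f (X \<union> Y) t \<partial>scalar_measure E x) = (\<integral>t. f X t + f Y t \<partial>scalar_measure E x)" for x
        by (subst Bochner_Integration.integral_add[OF fi[OF X] fi[OF Y]])
          (simp only: f(4)[OF X] f(4)[OF Y] f(4)[OF sets.Un[OF X Y]] povm_Un[OF pF X Y XY] quad_add)
    qed (use X Y in auto)
    have f_one: "f UNIV l = 1" if l: "l \<in> ?K" for l
    proof (rule pvm_eq_on_support[OF E f(2) _ fi _ _ l, of _ "\<lambda>_. 1"])
      show "(\<integral>t. f UNIV t \<partial>scalar_measure E x) = (\<integral>t. 1 \<partial>scalar_measure E x)" for x
        by (subst f(4)) (simp_all add: F1 quad_id measure_scalar_UNIV[OF E])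
    qed (auto intro!: integrable_cont)
    \<comment> \<open>Linearity and monotonicity of the extension carry additivity, bounds and
      normalization from the support to every \<open>l\<close>.\<close>
    define h where "h \<Delta> = extension ?K k (f \<Delta>)" for \<Delta>
    have h_cont: "continuous_on UNIV (h \<Delta>)" if "\<Delta> \<in> sets borel" for \<Delta>
      unfolding h_def by (rule ext(6)[OF f(3) f(2)]) (rule that)+
    have h_nonneg: "0 \<le> h \<Delta> l" if D: "\<Delta> \<in> sets borel" for \<Delta> l
    proof -
      have "extension ?K k (\<lambda>_. 0) l \<le> h \<Delta> l"
        unfolding h_def
        by (rule ext(4)[where M=0, OF _ f(3)[OF D] f_nonneg[OF D]]) simp_all
      then show ?thesis by (simp only: ext(2))
    qed
    have h_le: "h \<Delta> l \<le> c * measure \<nu> \<Delta>" if D: "\<Delta> \<in> sets borel" for \<Delta> l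
    proof -
      have "h \<Delta> l \<le> extension ?K k (\<lambda>_. norm (F \<Delta>)) l"
        unfolding h_def
        by (rule ext(4)[where N="norm (F \<Delta>)", OF f(3)[OF D] _ abs_le_D1[OF f(3)[OF D]]]) simp
      then show ?thesis unfolding ext(2) using bd[OF D] by (rule order_trans)
    qed
    have h_add: "h (X \<union> Y) l = h X l + h Y l"
      if "X \<in> sets borel" "Y \<in> sets borel" "X \<inter> Y = {}" for X Y l
    proof -
      have "h (X \<union> Y) l = extension ?K k (\<lambda>t. f X t + f Y t) l"
        unfolding h_def by (rule ext(5)) (rule f_add[OF that])
      also have "\<dots> = h X l + h Y l"
        unfolding h_def by (rule ext(3)[OF f(3) f(3)]) (rule that)+
      finally show ?thesis .
    qed
    have h_one: "h UNIV l = 1" for l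
      using ext(5)[of "f UNIV" "\<lambda>_. 1" l] ext(2)[of 1 l] f_one by (simp add: h_def)
    obtain \<mu> where \<mu>: "markov_kernel \<mu>" "strong_feller \<mu>"
      "\<And>\<Delta> l. \<Delta> \<in> sets borel \<Longrightarrow> measure (\<mu> l) \<Delta> = h \<Delta> l"
      using kernel_from_bounded_additive[OF \<nu>, of h c] h_nonneg h_le h_add h_one h_cont by blast
    have "(\<integral>l. measure (\<mu> l) \<Delta> \<partial>scalar_measure E x) = quad (F \<Delta>) x" if D: "\<Delta> \<in> sets borel" for \<Delta> x
    proof -
      have "(\<integral>l. measure (\<mu> l) \<Delta> \<partial>scalar_measure E x) = (\<integral>l. f \<Delta> l \<partial>scalar_measure E x)"
        unfolding \<mu>(3)[OF D]
        by (rule integral_cong_AE)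
          (use AE_pvm_support[OF p, of x] f(1)[OF D] borel_measurable_continuous_onI[OF h_cont[OF D]]
            in \<open>auto simp: h_def ext(1) elim!: AE_mp cong: measurable_cong_sets\<close>)
      then show ?thesis by (simp add: f(4)[OF D])
    qed
    then show ?thesis using \<mu>(1,2) by blast
  qed
  then obtain \<mu> where \<mu>: "markov_kernel \<mu>" "strong_feller \<mu>"
    "\<And>\<Delta> x. \<Delta> \<in> sets borel \<Longrightarrow> (\<integral>l. measure (\<mu> l) \<Delta> \<partial>scalar_measure E x) = quad (F \<Delta>) x"
    by blast
  have "has_spectral_integral E (\<lambda>l. measure (\<mu> l) \<Delta>) UNIV (blinfun_apply (F \<Delta>))"
    if D: "\<Delta> \<in> sets borel" for \<Delta>
  proof (rule has_spectral_integralI[OF povm_herm[OF pF D] _ _ \<mu>(3)[OF D]])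
    have cont: "continuous_on UNIV (\<lambda>l. measure (\<mu> l) \<Delta>)"
      using \<mu>(2) D by (simp add: strong_feller_def)
    then show "(\<lambda>l. measure (\<mu> l) \<Delta>) \<in> borel_measurable borel" by (rule borel_measurable_continuous_onI)
    show "integrable (scalar_measure E x) (\<lambda>l. (measure (\<mu> l) \<Delta>)\<^sup>2)" for x
      by (intro integrable_cont continuous_intros cont)
  qed
  then show ?thesis
    using herm_self_adjoint[OF hA] spA \<mu>(1,2) by blast
qed

subsection \<open>Commutativity of functions of a self-adjoint operator\<close>

text \<open>At y = E B x the form of \<open>E B\<close> is already the full |y|^2, while E of the
  disjoint union is at most the identity.\<close>

lemma pvm_orthogonal:
  assumes E: "pvm E" and AB: "A \<in> sets borel" "B \<in> sets borel" "A \<inter> B = {}"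
  shows "E A (E B x) = 0"
proof -
  note p = pvm_povm[OF E]
  let ?y = "E B x"
  have id: "E C o\<^sub>L E C = E C" and h: "herm (E C)" if "C \<in> sets borel" for C
    using E povm_herm[OF p] that by (auto simp: pvm_def)
  have y: "E B ?y = ?y" using id[OF AB(2)] by (metis blinfun_apply_blinfun_compose)
  have "quad (E A) ?y + quad (E B) ?y = quad (E (A \<union> B)) ?y"
    by (simp add: povm_Un[OF p AB] quad_add)
  also have "\<dots> \<le> (norm ?y)\<^sup>2"
    using povm_unit_op[of E "A \<union> B"] E AB by (auto simp: pvm_def unit_op_def)
  finally have "(norm (E A ?y))\<^sup>2 \<le> 0"
    by (simp add: quad_idempotent[OF h id] AB y)
  then show ?thesis by simp
qed

text \<open>Both sets are split along their intersection, and the pieces over disjoint sets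
  annihilate each other. In particular the projections commute.\<close>

lemma pvm_mult:
  assumes E: "pvm E" and A: "A \<in> sets borel" and B: "B \<in> sets borel"
  shows "E A (E B x) = E (A \<inter> B) x"
proof -
  note p = pvm_povm[OF E]
  have eB: "E B = E (A \<inter> B) + E (B - A)"
    by (subst povm_Un[OF p, symmetric]) (use A B in \<open>auto intro!: arg_cong[of _ _ E]\<close>)
  have eA: "E A = E (A \<inter> B) + E (A - B)"
    by (subst povm_Un[OF p, symmetric]) (use A B in \<open>auto intro!: arg_cong[of _ _ E]\<close>)
  have "E A (E B x) = E A (E (A \<inter> B) x) + E A (E (B - A) x)"
    by (simp only: eB blinfun.add_left blinfun.add_right)
  also have "E A (E (B - A) x) = 0" by (rule pvm_orthogonal[OF E]) (use A B in auto)
  also have "E A (E (A \<inter> B) x) = E (A \<inter> B) (E (A \<inter> B) x) + E (A - B) (E (A \<inter> B) x)"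
    by (subst eA) (simp only: blinfun.add_left)
  also have "E (A - B) (E (A \<inter> B) x) = 0" by (rule pvm_orthogonal[OF E]) (use A B in auto)
  also have "E (A \<inter> B) (E (A \<inter> B) x) = E (A \<inter> B) x"
    using E A B unfolding pvm_def by (metis blinfun_apply_blinfun_compose sets.Int)
  finally show ?thesis by simp
qed

text \<open>Uniform approximation of f by simple functions approximates \<open>T\<close> in norm by
  combinations of projections, thanks to the numerical radius bound; \<open>X\<close> commutes with
  each of them.\<close>

lemma spectral_integral_commute:
  assumes E: "pvm E" and f: "f \<in> borel_measurable borel" "\<And>t. 0 \<le> f t" "\<And>t. f t \<le> (1::real)"
    and T: "herm T" "\<And>x. quad T x = (\<integral>t. f t \<partial>scalar_measure E x)"
    and X: "\<And>B. B \<in> sets borel \<Longrightarrow> E B o\<^sub>L X = X o\<^sub>L E B"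
  shows "T o\<^sub>L X = X o\<^sub>L T"
proof -
  note p = pvm_povm[OF E]
  \<comment> \<open>Level sets of f in steps of 1 / N. The index k = N catches the points where f is
    1, whence the sums up to N inclusive.\<close>
  define B where "B N k = {t. real k \<le> real N * f t \<and> real N * f t < real k + 1}" for N k :: nat
  have B: "B N k \<in> sets borel" for N k
  proof -
    note f(1)[measurable]
    have "{t \<in> space borel. real k \<le> real N * f t \<and> real N * f t < real k + 1} \<in> sets borel"
      by measurable
    then show ?thesis by (simp add: B_def)
  qed
  define s where "s N t = (\<Sum>k\<le>N. (real k / real N) * indicator (B N k) t)" for N t
  define S where "S N = (\<Sum>k\<le>N. (real k / real N) *\<^sub>R E (B N k))" for N
  have hS: "herm (S N)" for N
    unfolding S_def by (intro herm_sum herm_scaleR povm_herm[OF p] B)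
  have i: "integrable (scalar_measure E x) g" if "g \<in> borel_measurable borel" "\<And>t. \<bar>g t\<bar> \<le> C" for g :: "real \<Rightarrow> real" and C x
    by (rule finite_measure.integrable_const_bound[OF finite_scalar_measure[OF p], of _ C])
      (use that in \<open>auto cong: measurable_cong_sets\<close>)
  have ii: "integrable (scalar_measure E x) (indicator (B N k) :: real \<Rightarrow> real)" for x N k
    by (rule i[of _ 1]) (use B in auto)
  have int_s: "integrable (scalar_measure E x) (s N)" for x N
    unfolding s_def by (intro Bochner_Integration.integrable_sum integrable_mult_right ii)
  have if': "integrable (scalar_measure E x) f" for x
    by (rule i[OF f(1), of 1]) (use f in auto)
  have qS: "quad (S N) x = (\<integral>t. s N t \<partial>scalar_measure E x)" for N x
    unfolding s_def S_def quad_sum quad_scaleR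
    by (subst Bochner_Integration.integral_sum)
      (auto intro!: integrable_mult_right ii sum.cong simp: measure_scalar_measure[OF p B])
  have close: "0 \<le> f t - s N t \<and> f t - s N t \<le> 1 / real N" if N: "N > 0" for N t
  proof -
    define k where "k = nat \<lfloor>real N * f t\<rfloor>"
    have "0 \<le> real N * f t" using f(2) by simp
    then have rk: "real k = of_int \<lfloor>real N * f t\<rfloor>" by (simp add: k_def)
    have kb: "real k \<le> real N * f t" "real N * f t < real k + 1" unfolding rk by linarith+
    have "real N * f t \<le> real N * 1" by (intro mult_left_mono f) simp
    then have kN: "k \<le> N" using kb by simp
    have "(real j / real N) * indicator (B N j) t = (if j = k then real k / real N else 0)" for j
    proof (cases "j = k")
      case False
      then have "real j + 1 \<le> real k \<or> real k + 1 \<le> real j" by linarith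
      then show ?thesis using kb by (auto simp: B_def indicator_def)
    qed (use kb in \<open>simp add: B_def\<close>)
    then have sk: "s N t = real k / real N" unfolding s_def using kN by simp
    have "f t - real k / real N = (real N * f t - real k) / real N"
      using N by (simp add: diff_divide_distrib)
    then show ?thesis unfolding sk using kb by (auto intro!: divide_right_mono)
  qed
  have nS: "norm (T - S N) \<le> 1 / real N" if N: "N > 0" for N
  proof (rule herm_norm_le[OF herm_diff[OF T(1) hS]])
    fix x
    have q: "quad (T - S N) x = (\<integral>t. f t - s N t \<partial>scalar_measure E x)"
      by (simp add: quad_diff T(2) qS if' int_s)
    have "0 \<le> quad (T - S N) x"
      unfolding q by (rule integral_nonneg_AE) (use close[OF N] in auto)
    moreover have "quad (T - S N) x \<le> (\<integral>t. 1 / real N \<partial>scalar_measure E x)"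
      unfolding q
    proof (rule integral_mono)
      show "integrable (scalar_measure E x) (\<lambda>t. f t - s N t)"
        by (intro Bochner_Integration.integrable_diff if' int_s)
      show "integrable (scalar_measure E x) (\<lambda>t. 1 / real N)"
        by (rule i[of _ "1 / real N"]) simp_all
    qed (use close[OF N] in blast)
    ultimately show "\<bar>quad (T - S N) x\<bar> \<le> 1 / real N * (norm x)\<^sup>2"
      by (simp add: measure_scalar_UNIV[OF E])
  qed simp
  \<comment> \<open>Shifted to \<open>Suc n\<close> because the estimate assumes N > 0.\<close>
  have "norm (T - S (Suc n)) \<le> 1 * (1 / real (Suc n))" for n
    unfolding mult_1 by (rule nS) simp
  then have "(\<lambda>n. S (Suc n)) \<longlonglongrightarrow> T"
    by (rule norm_null_tendsto) (rule LIMSEQ_Suc[OF lim_1_over_n])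
  then have "(\<lambda>n. S (Suc n) x) \<longlonglongrightarrow> T x" for x by (intro blinfun.tendsto tendsto_const)
  then show ?thesis
  proof (rule strong_limit_commute)
    fix n
    have "E (B N k) (X x) = X (E (B N k) x)" for N k x
      using X[OF B] by (metis blinfun_apply_blinfun_compose)
    then show "S (Suc n) o\<^sub>L X = X o\<^sub>L S (Suc n)"
      by (intro blinfun_eqI)
        (simp add: S_def blinfun.sum_left blinfun.sum_right blinfun.scaleR_left blinfun.scaleR_right del: sum.atMost_Suc)
  qed
qed

text \<open>The commutation lemma is applied twice: with X = E C it shows that every
  \<open>F \<Delta>\<close> commutes with the projections, which then permits X = F
  \<Delta>'.\<close>

lemma kernel_integral_imp_commutative:
  fixes F :: "real set \<Rightarrow> ('a::chilbert_space \<Rightarrow>\<^sub>L 'a)"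
  assumes F: "povm F" and E: "pvm E" and \<mu>: "markov_kernel \<mu>"
    and int: "\<And>\<Delta>. \<Delta> \<in> sets borel \<Longrightarrow>
      has_spectral_integral E (\<lambda>l. measure (\<mu> l) \<Delta>) UNIV (blinfun_apply (F \<Delta>))"
  shows "commutative_povm F"
proof -
  have prob: "prob_space (\<mu> l)" for l
    using measurable_space[OF \<mu>[unfolded markov_kernel_def], of l] by (simp add: space_prob_algebra)
  have comm: "F \<Delta> o\<^sub>L X = X o\<^sub>L F \<Delta>"
    if D: "\<Delta> \<in> sets borel" and X: "\<And>B. B \<in> sets borel \<Longrightarrow> E B o\<^sub>L X = X o\<^sub>L E B" for \<Delta> X
  proof (rule spectral_integral_commute[OF E _ _ _ povm_herm[OF F D] _ X])
    show "(\<lambda>l. measure (\<mu> l) \<Delta>) \<in> borel_measurable borel"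
      using int[OF D] by (simp add: has_spectral_integral_def)
    show "quad (F \<Delta>) x = (\<integral>l. measure (\<mu> l) \<Delta> \<partial>scalar_measure E x)" for x
      using int[OF D] by (simp add: has_spectral_integral_def quad_def)
    show "measure (\<mu> l) \<Delta> \<le> 1" for l by (rule prob_space.prob_le_1[OF prob])
  qed auto
  have EE: "E B o\<^sub>L E C = E C o\<^sub>L E B" if "B \<in> sets borel" "C \<in> sets borel" for B C
    by (rule blinfun_eqI) (simp add: pvm_mult[OF E] that Int_commute)
  have FE: "F \<Delta> o\<^sub>L E C = E C o\<^sub>L F \<Delta>" if "\<Delta> \<in> sets borel" "C \<in> sets borel" for \<Delta> C
    by (rule comm[OF that(1)]) (rule EE[OF _ that(2)])
  show ?thesis
    unfolding commutative_povm_def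
    by (intro ballI comm) (auto simp: FE)
qed

theorem corollary6p3:
  fixes F :: "real set \<Rightarrow> ('a::chilbert_space \<Rightarrow>\<^sub>L 'a)" and \<nu> :: "real measure"
  assumes "normalized_povm F"
    and "finite_measure \<nu>" and "sets \<nu> = sets borel"
    and "absolutely_continuous_povm \<nu> F"
  shows "commutative_povm F \<longleftrightarrow>
    (\<exists>D A E \<mu>. self_adjoint D A \<and> is_spectral_measure E D A \<and>
       markov_kernel \<mu> \<and> strong_feller \<mu> \<and>
       (\<forall>\<Delta>\<in>sets borel.
          has_spectral_integral E (\<lambda>l. measure (\<mu> l) \<Delta>) UNIV (blinfun_apply (F \<Delta>))))"
proof
  assume "commutative_povm F"
  with assms show "\<exists>D A E \<mu>. self_adjoint D A \<and> is_spectral_measure E D A \<and>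
       markov_kernel \<mu> \<and> strong_feller \<mu> \<and>
       (\<forall>\<Delta>\<in>sets borel.
          has_spectral_integral E (\<lambda>l. measure (\<mu> l) \<Delta>) UNIV (blinfun_apply (F \<Delta>)))"
    by (rule commutative_imp_strong_feller)
next
  assume "\<exists>D A E \<mu>. self_adjoint D A \<and> is_spectral_measure E D A \<and>
       markov_kernel \<mu> \<and> strong_feller \<mu> \<and>
       (\<forall>\<Delta>\<in>sets borel.
          has_spectral_integral E (\<lambda>l. measure (\<mu> l) \<Delta>) UNIV (blinfun_apply (F \<Delta>)))"
  then show "commutative_povm F"
    using assms(1) kernel_integral_imp_commutative
    unfolding is_spectral_measure_def normalized_povm_def by blast
qed

end
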